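(* Let $G$ be a diffeological group with identity $e$. Then $T^H(G)$ is a diffeological vector space over $G$, and $T^H(G)$, $G\times T_e^H(G)$, $T^{dvs}(G)$ and $G\times T_e^{dvs}(G)$ are all isomorphic as diffeological vector spaces over $G$. Therefore $T_g^H(G)=T_g^{dvs}(G)$ for every $g\in G$.
   Context: A diffeological space is a set with, for every open subset $U$ of every $\mathbb{R}^n$, a set of maps $U\to X$ called plots, containing constants, closed under precomposition with smooth maps, and satisfying the sheaf condition; smooth maps send plots to plots. A diffeological group is a group with a diffeology for which multiplication and inversion are smooth. The internal tangent space $T_x(X)$ is the colimit in real vector spaces, over the category of plots $p:U\to X$ with $U$ a connected open neighbourhood of $0$ in some $\mathbb{R}^n$ and $p(0)=x$ (morphisms: smooth $f:U\to V$ with $f(0)=0$ and $q\circ f=p$), of $p\mapsto T_0(U)$, $f\mapsto f_*$. The internal tangent bundle is $TX=\coprod_x T_x(X)$. For a plot $f:U\to X$ with $U$ connected, $Tf:TU\to TX$ sends $T_u(U)$ to $T_{f(u)}(X)$ via $T_u(U)\cong T_0(U-u)\to T_{f(u)}(X)$ induced by $w\mapsto f(w+u)$. Hector's diffeology on $TX$ is generated by all such $Tf$; $T^H(X)$ denotes $TX$ with it. A diffeological vector space over $X$ is a diffeological space $V$ with a smooth map $V\to X$ and vector space structures on fibres such that fibrewise addition $V\times_XV\to V$, scalar multiplication $\mathbb{R}\times V\to V$ and the zero section are smooth. The dvs diffeology is the smallest diffeology on $TX$ containing Hector's diffeology that makes $TX\to X$ a diffeological vector space over $X$; $T^{dvs}(X)$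 denotes $TX$ with it. $T_x^H(X)$ and $T_x^{dvs}(X)$ denote $T_x(X)$ with the corresponding sub-diffeologies; $G\times T_e^H(G)$ etc. are regarded over $G$ via the first projection. *)

theory Defs
  imports "HOL-Analysis.Analysis" "HOL-Algebra.Group"
begin

type_synonym vec = "nat \<Rightarrow> real"

definition Rn :: "nat \<Rightarrow> vec set" where
  "Rn n = {x. \<forall>i\<ge>n. x i = 0}"

definition zv :: vec where "zv = (\<lambda>_. 0)"

definition vadd :: "vec \<Rightarrow> vec \<Rightarrow> vec" where
  "vadd x y = (\<lambda>i. x i + y i)"

text \<open>U is an open subset of R^n (topology of R^n = subspace of the product topology).\<close>
definition open_Rn :: "nat \<Rightarrow> vec set \<Rightarrow> bool" where
  "open_Rn n U \<longleftrightarrow> openin (top_of_set (Rn n)) U"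

definition partial :: "nat \<Rightarrow> (vec \<Rightarrow> real) \<Rightarrow> vec \<Rightarrow> real" where
  "partial i g x = deriv (\<lambda>t. g (x(i := x i + t))) 0"

fun iter_partial :: "nat list \<Rightarrow> (vec \<Rightarrow> real) \<Rightarrow> vec \<Rightarrow> real" where
  "iter_partial [] g = g"
| "iter_partial (i # is) g = partial i (iter_partial is g)"

definition smooth_fn :: "nat \<Rightarrow> vec set \<Rightarrow> (vec \<Rightarrow> real) \<Rightarrow> bool" where
  "smooth_fn m V g \<longleftrightarrow> open_Rn m V \<and>
     (\<forall>is. set is \<subseteq> {..<m} \<longrightarrow>
        continuous_on V (iter_partial is g) \<and>
        (\<forall>i<m. \<forall>x\<in>V. (\<lambda>t. iter_partial is g (x(i := x i + t))) differentiable (at 0)))"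

definition smooth_map :: "nat \<Rightarrow> vec set \<Rightarrow> nat \<Rightarrow> (vec \<Rightarrow> vec) \<Rightarrow> bool" where
  "smooth_map m V n f \<longleftrightarrow> open_Rn m V \<and> f ` V \<subseteq> Rn n \<and> (\<forall>j<n. smooth_fn m V (\<lambda>x. f x j))"

definition jac0 :: "nat \<Rightarrow> nat \<Rightarrow> (vec \<Rightarrow> vec) \<Rightarrow> vec \<Rightarrow> vec" where
  "jac0 n m f v = (\<lambda>j. if j < m then (\<Sum>i<n. partial i (\<lambda>x. f x j) zv * v i) else 0)"

text \<open>A diffeology on a carrier set X: D n U p means p : U -> X is a plot, U open in R^n.
  Plots are regarded as maps on U only (extensionality axiom).\<close>
type_synonym 'b diffeo = "nat \<Rightarrow> vec set \<Rightarrow> (vec \<Rightarrow> 'b) \<Rightarrow> bool"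

definition diffeology :: "'b set \<Rightarrow> 'b diffeo \<Rightarrow> bool" where
  "diffeology X D \<longleftrightarrow>
     (\<forall>n U p. D n U p \<longrightarrow> open_Rn n U \<and> p ` U \<subseteq> X) \<and>
     (\<forall>n U p q. D n U p \<longrightarrow> (\<forall>u\<in>U. p u = q u) \<longrightarrow> D n U q) \<and>
     (\<forall>n U x. open_Rn n U \<longrightarrow> x \<in> X \<longrightarrow> D n U (\<lambda>_. x)) \<and>
     (\<forall>n U p m V f. D n U p \<longrightarrow> smooth_map m V n f \<longrightarrow> f ` V \<subseteq> U \<longrightarrow> D m V (p \<circ> f)) \<and>
     (\<forall>n U p. open_Rn n U \<longrightarrow> p ` U \<subseteq> X \<longrightarrow>
        (\<forall>u\<in>U. \<exists>W. open_Rn n W \<and> u \<in> W \<and> W \<subseteq> U \<and> D n W p) \<longrightarrow> D n U p)"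

definition smooth :: "'b diffeo \<Rightarrow> 'c diffeo \<Rightarrow> ('b \<Rightarrow> 'c) \<Rightarrow> bool" where
  "smooth D1 D2 f \<longleftrightarrow> (\<forall>n U p. D1 n U p \<longrightarrow> D2 n U (f \<circ> p))"

definition gen_diff :: "'b set \<Rightarrow> (nat \<times> vec set \<times> (vec \<Rightarrow> 'b)) set \<Rightarrow> 'b diffeo" where
  "gen_diff Y F n U p \<longleftrightarrow>
     (\<forall>D. diffeology Y D \<and> (\<forall>(m, W, g)\<in>F. D m W g) \<longrightarrow> D n U p)"

definition sub_diff :: "'b diffeo \<Rightarrow> 'b set \<Rightarrow> 'b diffeo" where
  "sub_diff D A n U p \<longleftrightarrow> D n U p \<and> p ` U \<subseteq> A"

definition prod_diff :: "'b diffeo \<Rightarrow> 'c diffeo \<Rightarrow> ('b \<times> 'c) diffeo" where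
  "prod_diff D1 D2 n U P \<longleftrightarrow> D1 n U (fst \<circ> P) \<and> D2 n U (snd \<circ> P)"

definition diffeological_group :: "('g, 'm) monoid_scheme \<Rightarrow> 'g diffeo \<Rightarrow> bool" where
  "diffeological_group G D \<longleftrightarrow> group G \<and> diffeology (carrier G) D \<and>
     (\<forall>n U P Q. D n U P \<longrightarrow> D n U Q \<longrightarrow> D n U (\<lambda>u. P u \<otimes>\<^bsub>G\<^esub> Q u)) \<and>
     (\<forall>n U P. D n U P \<longrightarrow> D n U (\<lambda>u. inv\<^bsub>G\<^esub> (P u)))"

definition fibre_vs :: "'v set \<Rightarrow> ('v \<Rightarrow> 'v \<Rightarrow> 'v) \<Rightarrow> (real \<Rightarrow> 'v \<Rightarrow> 'v) \<Rightarrow> 'v \<Rightarrow> bool" where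
  "fibre_vs F ad sm z \<longleftrightarrow> z \<in> F \<and>
     (\<forall>a\<in>F. \<forall>b\<in>F. ad a b \<in> F) \<and> (\<forall>r. \<forall>a\<in>F. sm r a \<in> F) \<and>
     (\<forall>a\<in>F. \<forall>b\<in>F. \<forall>c\<in>F. ad (ad a b) c = ad a (ad b c)) \<and>
     (\<forall>a\<in>F. \<forall>b\<in>F. ad a b = ad b a) \<and>
     (\<forall>a\<in>F. ad z a = a) \<and>
     (\<forall>a\<in>F. \<exists>b\<in>F. ad a b = z) \<and>
     (\<forall>r. \<forall>a\<in>F. \<forall>b\<in>F. sm r (ad a b) = ad (sm r a) (sm r b)) \<and>
     (\<forall>r s. \<forall>a\<in>F. sm (r + s) a = ad (sm r a) (sm s a)) \<and>
     (\<forall>r s. \<forall>a\<in>F. sm r (sm s a) = sm (r * s) a) \<and>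
     (\<forall>a\<in>F. sm 1 a = a)"

text \<open>(V, DV) is a diffeological vector space over (X, DX) with projection pr, fibrewise
  addition ad, scalar multiplication sm and zero section z.  Smoothness of addition on
  V \<times>_X V, of scalar multiplication on R \<times> V and of the zero section are stated via plots.\<close>
definition dvs :: "'v set \<Rightarrow> 'v diffeo \<Rightarrow> 'x set \<Rightarrow> 'x diffeo \<Rightarrow> ('v \<Rightarrow> 'x) \<Rightarrow>
    ('v \<Rightarrow> 'v \<Rightarrow> 'v) \<Rightarrow> (real \<Rightarrow> 'v \<Rightarrow> 'v) \<Rightarrow> ('x \<Rightarrow> 'v) \<Rightarrow> bool" where
  "dvs V DV X DX pr ad sm z \<longleftrightarrow> diffeology V DV \<and> diffeology X DX \<and>
     (\<forall>v\<in>V. pr v \<in> X) \<and> smooth DV DX pr \<and>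
     (\<forall>x\<in>X. pr (z x) = x \<and> fibre_vs {v\<in>V. pr v = x} ad sm (z x)) \<and>
     (\<forall>n U P Q. DV n U P \<longrightarrow> DV n U Q \<longrightarrow> (\<forall>u\<in>U. pr (P u) = pr (Q u)) \<longrightarrow>
        DV n U (\<lambda>u. ad (P u) (Q u))) \<and>
     (\<forall>n U r P. smooth_fn n U r \<longrightarrow> DV n U P \<longrightarrow> DV n U (\<lambda>u. sm (r u) (P u))) \<and>
     smooth DX DV z"

definition dvs_iso :: "'v set \<Rightarrow> 'v diffeo \<Rightarrow> ('v \<Rightarrow> 'x) \<Rightarrow> ('v \<Rightarrow> 'v \<Rightarrow> 'v) \<Rightarrow> (real \<Rightarrow> 'v \<Rightarrow> 'v) \<Rightarrow>
    'w set \<Rightarrow> 'w diffeo \<Rightarrow> ('w \<Rightarrow> 'x) \<Rightarrow> ('w \<Rightarrow> 'w \<Rightarrow> 'w) \<Rightarrow> (real \<Rightarrow> 'w \<Rightarrow> 'w) \<Rightarrow> bool" where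
  "dvs_iso V DV prV adV smV W DW prW adW smW \<longleftrightarrow>
     (\<exists>\<phi> \<psi>. (\<forall>v\<in>V. \<phi> v \<in> W \<and> \<psi> (\<phi> v) = v \<and> prW (\<phi> v) = prV v) \<and>
            (\<forall>w\<in>W. \<psi> w \<in> V \<and> \<phi> (\<psi> w) = w) \<and>
            smooth DV DW \<phi> \<and> smooth DW DV \<psi> \<and>
            (\<forall>a\<in>V. \<forall>b\<in>V. prV a = prV b \<longrightarrow> \<phi> (adV a b) = adW (\<phi> a) (\<phi> b)) \<and>
            (\<forall>r. \<forall>a\<in>V. \<phi> (smV r a) = smW r (\<phi> a)))"

section \<open>The internal tangent space as a colimit (direct sum modulo relations)\<close>

type_synonym 'a pidx = "nat \<times> vec set \<times> (vec \<Rightarrow> 'a)"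
type_synonym 'a fsum = "'a pidx \<Rightarrow> vec"
type_synonym 'a tvec = "'a fsum set"

definition pplot :: "'a diffeo \<Rightarrow> 'a \<Rightarrow> 'a pidx \<Rightarrow> bool" where
  "pplot D x P \<longleftrightarrow> (case P of (n, U, p) \<Rightarrow> D n U p \<and> connected U \<and> zv \<in> U \<and> p zv = x)"

definition pmor :: "'a pidx \<Rightarrow> 'a pidx \<Rightarrow> (vec \<Rightarrow> vec) \<Rightarrow> bool" where
  "pmor P Q f \<longleftrightarrow> (case P of (n, U, p) \<Rightarrow> case Q of (m, V, q) \<Rightarrow>
      smooth_map n U m f \<and> f ` U \<subseteq> V \<and> f zv = zv \<and> (\<forall>u\<in>U. q (f u) = p u))"

definition fzero :: "'a fsum" where "fzero = (\<lambda>_. zv)"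
definition fadd :: "'a fsum \<Rightarrow> 'a fsum \<Rightarrow> 'a fsum" where
  "fadd c d = (\<lambda>P. vadd (c P) (d P))"
definition fscale :: "real \<Rightarrow> 'a fsum \<Rightarrow> 'a fsum" where
  "fscale r c = (\<lambda>P i. r * c P i)"
definition fsub :: "'a fsum \<Rightarrow> 'a fsum \<Rightarrow> 'a fsum" where
  "fsub c d = fadd c (fscale (-1) d)"
definition delta :: "'a pidx \<Rightarrow> vec \<Rightarrow> 'a fsum" where
  "delta P v = (\<lambda>Q. if Q = P then v else zv)"

text \<open>Elements of the direct sum of T_0(U) = R^n over pointed plots at x.\<close>
definition is_fsum :: "'a diffeo \<Rightarrow> 'a \<Rightarrow> 'a fsum \<Rightarrow> bool" where
  "is_fsum D x c \<longleftrightarrow> finite {P. c P \<noteq> zv} \<and> (\<forall>P. c P \<noteq> zv \<longrightarrow> pplot D x P) \<and>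
     (\<forall>P. c P \<in> Rn (fst P))"

text \<open>Subspace of relations identifying v in T_0(U) with f_*(v) for morphisms f.\<close>
inductive_set rel :: "'a diffeo \<Rightarrow> 'a \<Rightarrow> 'a fsum set" for D x where
  rel_zero: "fzero \<in> rel D x"
| rel_gen: "pplot D x (n, U, p) \<Longrightarrow> pplot D x (m, V, q) \<Longrightarrow> pmor (n, U, p) (m, V, q) f \<Longrightarrow>
    v \<in> Rn n \<Longrightarrow> fsub (delta (n, U, p) v) (delta (m, V, q) (jac0 n m f v)) \<in> rel D x"
| rel_add: "c \<in> rel D x \<Longrightarrow> d \<in> rel D x \<Longrightarrow> fadd c d \<in> rel D x"
| rel_scale: "c \<in> rel D x \<Longrightarrow> fscale r c \<in> rel D x"

definition tcls :: "'a diffeo \<Rightarrow> 'a \<Rightarrow> 'a fsum \<Rightarrow> 'a tvec" where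
  "tcls D x c = {c'. is_fsum D x c' \<and> fsub c c' \<in> rel D x}"

definition Tspace :: "'a diffeo \<Rightarrow> 'a \<Rightarrow> 'a tvec set" where
  "Tspace D x = tcls D x ` {c. is_fsum D x c}"

definition tadd :: "'a diffeo \<Rightarrow> 'a \<Rightarrow> 'a tvec \<Rightarrow> 'a tvec \<Rightarrow> 'a tvec" where
  "tadd D x a b = tcls D x (fadd (SOME c. c \<in> a) (SOME c. c \<in> b))"
definition tscale :: "'a diffeo \<Rightarrow> 'a \<Rightarrow> real \<Rightarrow> 'a tvec \<Rightarrow> 'a tvec" where
  "tscale D x r a = tcls D x (fscale r (SOME c. c \<in> a))"
definition tzero :: "'a diffeo \<Rightarrow> 'a \<Rightarrow> 'a tvec" where
  "tzero D x = tcls D x fzero"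

definition TB :: "'a set \<Rightarrow> 'a diffeo \<Rightarrow> ('a \<times> 'a tvec) set" where
  "TB X D = {(x, t). x \<in> X \<and> t \<in> Tspace D x}"

definition tbadd :: "'a diffeo \<Rightarrow> ('a \<times> 'a tvec) \<Rightarrow> ('a \<times> 'a tvec) \<Rightarrow> ('a \<times> 'a tvec)" where
  "tbadd D y y' = (fst y, tadd D (fst y) (snd y) (snd y'))"
definition tbscale :: "'a diffeo \<Rightarrow> real \<Rightarrow> ('a \<times> 'a tvec) \<Rightarrow> ('a \<times> 'a tvec)" where
  "tbscale D r y = (fst y, tscale D (fst y) r (snd y))"
definition tbzero :: "'a diffeo \<Rightarrow> 'a \<Rightarrow> ('a \<times> 'a tvec)" where
  "tbzero D x = (x, tzero D x)"

text \<open>Coordinates on TU = U \<times> R^n, viewed inside R^(2n).\<close>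
definition fstpart :: "nat \<Rightarrow> vec \<Rightarrow> vec" where
  "fstpart n w = (\<lambda>i. if i < n then w i else 0)"
definition sndpart :: "nat \<Rightarrow> vec \<Rightarrow> vec" where
  "sndpart n w = (\<lambda>i. if i < n then w (n + i) else 0)"

text \<open>Tf : TU -> TX for a plot f : U -> X with U connected: (u, v) maps to the class of v
  in T_0(U - u) for the pointed plot w \<mapsto> f (w + u).\<close>
definition Tplot :: "'a diffeo \<Rightarrow> nat \<Rightarrow> vec set \<Rightarrow> (vec \<Rightarrow> 'a) \<Rightarrow> vec \<Rightarrow> ('a \<times> 'a tvec)" where
  "Tplot D n U f w =
     (let u = fstpart n w; v = sndpart n w in
      (f u, tcls D (f u) (delta (n, {z \<in> Rn n. vadd z u \<in> U}, (\<lambda>z. f (vadd z u))) v)))"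

definition hector_gens :: "'a diffeo \<Rightarrow> (nat \<times> vec set \<times> (vec \<Rightarrow> ('a \<times> 'a tvec))) set" where
  "hector_gens D = {(2 * n, {w \<in> Rn (2 * n). fstpart n w \<in> U}, Tplot D n U f) | n U f.
                     D n U f \<and> connected U}"

definition hector :: "'a set \<Rightarrow> 'a diffeo \<Rightarrow> ('a \<times> 'a tvec) diffeo" where
  "hector X D = gen_diff (TB X D) (hector_gens D)"

definition dvs_diff :: "'a set \<Rightarrow> 'a diffeo \<Rightarrow> ('a \<times> 'a tvec) diffeo" where
  "dvs_diff X D n U p \<longleftrightarrow>
     (\<forall>D'. (\<forall>m W q. hector X D m W q \<longrightarrow> D' m W q) \<and>
           dvs (TB X D) D' X D fst (tbadd D) (tbscale D) (tbzero D) \<longrightarrow> D' n U p)"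

definition Tfib :: "'a set \<Rightarrow> 'a diffeo \<Rightarrow> 'a \<Rightarrow> ('a \<times> 'a tvec) set" where
  "Tfib X D x = {y \<in> TB X D. fst y = x}"

definition triv_add :: "'a diffeo \<Rightarrow> ('g \<times> ('a \<times> 'a tvec)) \<Rightarrow> ('g \<times> ('a \<times> 'a tvec)) \<Rightarrow> ('g \<times> ('a \<times> 'a tvec))" where
  "triv_add D a b = (fst a, tbadd D (snd a) (snd b))"
definition triv_scale :: "'a diffeo \<Rightarrow> real \<Rightarrow> ('g \<times> ('a \<times> 'a tvec)) \<Rightarrow> ('g \<times> ('a \<times> 'a tvec))" where
  "triv_scale D r a = (fst a, tbscale D r (snd a))"
definition triv_zero :: "'a diffeo \<Rightarrow> 'a \<Rightarrow> 'g \<Rightarrow> ('g \<times> ('a \<times> 'a tvec))" where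
  "triv_zero D e g = (g, tbzero D e)"

end

theory Submission
  imports Defs
begin

text \<open>
  Translations make tangent vectors of plots addable. If \<open>f\<close> and \<open>g\<close> are plots with
  \<open>f(a) = g(b)\<close>, the plot \<open>k(x, y, y') = f(x) g(y')\<^sup>-\<^sup>1 g(y)\<close> restricts to \<open>f\<close> along \<open>x\<close> and to
  \<open>g\<close> along \<open>y\<close> at \<open>(a, b, b)\<close>, so \<open>Tf(a, v) + Tg(b, w) = Tk((a, b, b), (v, w, 0))\<close>.
  Consequently every tangent vector comes from a single plot, Hector plots are exactly the maps that
  are locally \<open>Tf \<circ> \<alpha>\<close> with \<open>\<alpha>\<close> smooth, and fibrewise addition of Hector plots is smooth. So Hector's
  diffeology already makes the tangent bundle a diffeological vector space and coincides with the dvs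
  diffeology. Left translation trivialises the bundle; it is smooth because
  \<open>h(z) f(x)\<close> is a plot of both variables and
  \<open>L\<^bsub>h(z)\<^esub> Tf(a, v)\<close> is its tangent map at \<open>((z, a), (0, v))\<close>.
\<close>

section \<open>Calculus on open subsets of coordinate spaces\<close>

text \<open>The variable y' makes addition smooth in families. If f(a z) = g(b z) while z varies,
  freezing g(b z) inside the auxiliary plot would give another plot for each z, whereas a Hector
  plot must locally be the tangent map of one plot after a smooth map. With y' as a coordinate, k is
  fixed and only the base point (a z, b z, b z) moves; the zero velocity in the last slot keeps this
  coordinate from contributing to the sum. In the trivialisation the translating element becomes a
  coordinate for the same reason.

  That one plot carries each tangent vector matters already for constant maps: every diffeology
  contains them, so the maps of the form Tf after a smooth map must include them before they can be
  shown to form one.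

  Smoothness is defined by iterated partial derivatives, so closure under composition has to come
  from a chain rule for continuous partials. In the colimit, the only morphisms whose Jacobian has
  to be computed are inclusions of a block of coordinates.\<close>

lemma open_Rn_subset: "open_Rn n U \<Longrightarrow> U \<subseteq> Rn n"
  by (auto simp: open_Rn_def dest: openin_imp_subset)

lemma tendsto_coordinatewise:
  fixes f :: "'a \<Rightarrow> vec"
  assumes "\<And>i. ((\<lambda>x. f x i) \<longlongrightarrow> l i) F"
  shows "(f \<longlongrightarrow> l) F"
proof -
  have "limitin (product_topology (\<lambda>i. euclidean) UNIV) f l F"
    using assms by (simp add: limitin_componentwise)
  then show ?thesis by (simp add: euclidean_product_topology)
qed

lemma open_Rn_contains_cube:
  assumes "open_Rn n U" "x \<in> U"
  obtains e where "e > 0" "\<And>y. y \<in> Rn n \<Longrightarrow> (\<And>i. i < n \<Longrightarrow> \<bar>y i - x i\<bar> < e) \<Longrightarrow> y \<in> U"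
proof -
  obtain S where S: "open S" "U = Rn n \<inter> S"
    using assms(1) by (auto simp: open_Rn_def openin_open)
  then obtain B where B: "x \<in> (\<Pi>\<^sub>E i\<in>UNIV. B i)" "\<And>i. open (B i)" "(\<Pi>\<^sub>E i\<in>UNIV. B i) \<subseteq> S"
    using product_topology_open_contains_basis[of "\<lambda>i. euclidean" UNIV S x] assms(2)
    by (auto simp: open_fun_def)
  have "\<exists>e>0. \<forall>y. \<bar>y - x i\<bar> < e \<longrightarrow> y \<in> B i" for i
  proof -
    have "x i \<in> B i" using B(1) by auto
    then show ?thesis using B(2)[of i] by (force simp: open_dist dist_real_def)
  qed
  then obtain d where d: "\<And>i. d i > 0" "\<And>i y. \<bar>y - x i\<bar> < d i \<Longrightarrow> y \<in> B i"
    by metis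
  \<comment> \<open>Coordinates from \<open>n\<close> on vanish for both points, so finitely many
    radii suffice. The 1 keeps the set nonempty when \<open>n = 0\<close>.\<close>
  define e where "e = Min (insert 1 (d ` {..<n}))"
  have e: "e > 0" "\<And>i. i < n \<Longrightarrow> e \<le> d i"
    using d(1) by (auto simp: e_def)
  show thesis
  proof (rule that[OF e(1)])
    fix y assume y: "y \<in> Rn n" "\<And>i. i < n \<Longrightarrow> \<bar>y i - x i\<bar> < e"
    have "y i \<in> B i" for i
    proof (cases "i < n")
      case True
      then show ?thesis using d(2) e(2) y(2) by fastforce
    next
      case False
      have "x \<in> Rn n" using assms open_Rn_subset by blast
      then have "y i = x i" using False y(1) by (simp add: Rn_def)
      then show ?thesis using d by simp
    qed
    then show "y \<in> U" using B(3) S y(1) by auto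
  qed
qed

definition cube :: "nat \<Rightarrow> vec \<Rightarrow> real \<Rightarrow> vec set" where
  "cube n x e = {y \<in> Rn n. \<forall>i<n. \<bar>y i - x i\<bar> < e}"

lemma open_Rn_cube: "open_Rn n (cube n x e)"
proof -
  have "open (\<Inter>i\<in>{..<n}. {y::vec. \<bar>y i - x i\<bar> < e})"
    by (intro open_INT ballI open_Collect_less continuous_intros
        continuous_on_product_coordinates) simp
  moreover have "cube n x e = Rn n \<inter> (\<Inter>i\<in>{..<n}. {y::vec. \<bar>y i - x i\<bar> < e})"
    by (auto simp: cube_def)
  ultimately show ?thesis by (auto simp: open_Rn_def openin_open)
qed

lemma connected_cube:
  assumes "x \<in> Rn n" "e > 0"
  shows "connected (cube n x e)"
proof -
  have "path_component (cube n x e) x y" if y: "y \<in> cube n x e" for y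
  proof -
    define g where "g = (\<lambda>t::real. \<lambda>i. x i + t * (y i - x i))"
    have "path g"
      unfolding path_def g_def by (intro continuous_intros)
    moreover have "g t \<in> cube n x e" if t: "t \<in> {0..1}" for t
    proof -
      have "\<bar>t * (y i - x i)\<bar> < e" if "i < n" for i
      proof -
        have "\<bar>t * (y i - x i)\<bar> \<le> 1 * \<bar>y i - x i\<bar>"
          unfolding abs_mult using t by (intro mult_right_mono) auto
        also have "\<dots> < e" using y that by (simp add: cube_def)
        finally show ?thesis .
      qed
      then show ?thesis using y assms by (auto simp: cube_def g_def Rn_def)
    qed
    ultimately show ?thesis
      unfolding path_component_def
      by (intro exI[of _ g]) (auto simp: path_image_def pathstart_def pathfinish_def g_def)
  qed
  then show ?thesis
    by (meson path_component_sym path_component_trans path_connected_component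
        path_connected_imp_connected)
qed

text \<open>Tangent maps are formed over connected domains, so a plot on an arbitrary domain is
  first cut down near each point.\<close>

lemma connected_nbhd:
  assumes "open_Rn n U" "x \<in> U"
  obtains W where "open_Rn n W" "connected W" "x \<in> W" "W \<subseteq> U"
proof -
  obtain e where "e > 0" "\<And>y. y \<in> Rn n \<Longrightarrow> (\<And>i. i < n \<Longrightarrow> \<bar>y i - x i\<bar> < e) \<Longrightarrow> y \<in> U"
    using open_Rn_contains_cube[OF assms] by blast
  moreover have "x \<in> Rn n" using assms open_Rn_subset by blast
  ultimately show thesis
    by (intro that[of "cube n x e"] open_Rn_cube connected_cube) (auto simp: cube_def)
qed

lemma open_Rn_whole: "open_Rn n (Rn n)"
  by (simp add: open_Rn_def)

lemma open_Rn_Int: "open_Rn n U \<Longrightarrow> open_Rn n V \<Longrightarrow> open_Rn n (U \<inter> V)"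
  by (simp add: open_Rn_def openin_Int)

lemma open_Rn_vimage:
  assumes "open_Rn n V" "open_Rn m U" "continuous_on U f" "f ` U \<subseteq> Rn n"
  shows "open_Rn m {x \<in> U. f x \<in> V}"
proof -
  have "openin (top_of_set U) (U \<inter> f -` V)"
    using assms by (intro continuous_openin_preimage[of U f "Rn n"]) (auto simp: open_Rn_def)
  then have "openin (top_of_set (Rn m)) (U \<inter> f -` V)"
    using assms(2) openin_trans unfolding open_Rn_def by blast
  moreover have "{x \<in> U. f x \<in> V} = U \<inter> f -` V" by auto
  ultimately show ?thesis by (simp add: open_Rn_def)
qed

section \<open>Partial derivatives, the chain rule and functions of class C^k\<close>

lemma eventually_line_in:
  assumes "open_Rn m V" "x \<in> V" "i < m"
  shows "\<forall>\<^sub>F t in nhds 0. x(i := x i + t) \<in> V"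
proof -
  obtain e where e: "e > 0" "\<And>y. y \<in> Rn m \<Longrightarrow> (\<And>k. k < m \<Longrightarrow> \<bar>y k - x k\<bar> < e) \<Longrightarrow> y \<in> V"
    using open_Rn_contains_cube[OF assms(1,2)] by blast
  have x: "x \<in> Rn m" using assms open_Rn_subset by blast
  have "x(i := x i + t) \<in> V" if "dist t 0 < e" for t
    using that e(1) x assms(3) by (intro e(2)) (auto simp: Rn_def)
  then show ?thesis using e(1) unfolding eventually_nhds_metric by blast
qed

text \<open>\<open>deriv\<close> yields some number even where no derivative exists, so
  \<open>partial\<close> alone cannot record differentiability.\<close>

definition has_partial :: "nat \<Rightarrow> (vec \<Rightarrow> real) \<Rightarrow> vec \<Rightarrow> real \<Rightarrow> bool" where
  "has_partial i g x d \<longleftrightarrow> ((\<lambda>t. g (x(i := x i + t))) has_real_derivative d) (at 0)"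

lemma differentiable_iff_has_partial:
  "(\<lambda>t. g (x(i := x i + t))) differentiable (at (0::real)) \<longleftrightarrow> has_partial i g x (partial i g x)"
  unfolding has_partial_def partial_def by (simp only: DERIV_deriv_iff_real_differentiable)

lemma has_partialD: "has_partial i g x d \<Longrightarrow> partial i g x = d"
  unfolding has_partial_def partial_def by (rule DERIV_imp_deriv)

lemma has_partial_shift:
  assumes "has_partial i g (x(i := s)) d"
  shows "((\<lambda>t. g (x(i := t))) has_real_derivative d) (at s)"
proof -
  have "((\<lambda>t. g (x(i := s + t))) has_real_derivative d) (at 0)"
    using assms unfolding has_partial_def fun_upd_upd fun_upd_same .
  then show ?thesis using DERIV_shift[of "\<lambda>t. g (x(i := t))" _ 0 s] by (simp add: add.commute)
qed

text \<open>In \<open>slot_derivative\<close> the increment of \<open>c\<close> may be positive,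
  negative or zero; bounding the mean value point by absolute values treats all three at
  once.\<close>

lemma MVT_unordered:
  fixes a b :: real
  assumes "\<And>s. \<bar>s - a\<bar> \<le> \<bar>b - a\<bar> \<Longrightarrow> (h has_real_derivative h' s) (at s)"
  shows "\<exists>s. \<bar>s - a\<bar> \<le> \<bar>b - a\<bar> \<and> h b - h a = h' s * (b - a)"
proof (cases a b rule: linorder_cases)
  case less
  have "\<exists>z. a < z \<and> z < b \<and> h b - h a = (b - a) * h' z"
    using less by (intro MVT2 assms) auto
  then obtain z where "a < z" "z < b" "h b - h a = (b - a) * h' z" by blast
  then show ?thesis using less by (intro exI[of _ z]) auto
next
  case greater
  have "\<exists>z. b < z \<and> z < a \<and> h a - h b = (a - b) * h' z"
    using greater by (intro MVT2 assms) auto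
  then obtain z where "b < z" "z < a" "h a - h b = (a - b) * h' z" by blast
  then show ?thesis using greater by (intro exI[of _ z]) (auto simp: algebra_simps)
qed auto

text \<open>The mean value theorem in the \<open>j\<close>-th slot; telescoping over the slots gives the chain rule.\<close>

lemma slot_derivative:
  assumes V: "open_Rn m V" "j < m"
    and diff: "\<And>x. x \<in> V \<Longrightarrow> has_partial j g x (partial j g x)"
    and cont: "continuous_on V (partial j g)"
    and y: "\<And>t. y t \<in> Rn m" "\<And>k. isCont (\<lambda>t. y t k) 0" "y 0 = p" "p \<in> V"
    and c: "(c has_real_derivative c') (at 0)" "c 0 = p j"
  shows "((\<lambda>t. g ((y t)(j := c t)) - g ((y t)(j := p j))) has_real_derivative partial j g p * c') (at 0)"
proof -
  obtain e where e: "e > 0" "\<And>x. x \<in> Rn m \<Longrightarrow> (\<And>i. i < m \<Longrightarrow> \<bar>x i - p i\<bar> < e) \<Longrightarrow> x \<in> V"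
    using open_Rn_contains_cube[OF V(1) y(4)] by blast
  have lim_y: "((\<lambda>t. y t k) \<longlongrightarrow> p k) (at 0)" for k
    using y(2)[of k] y(3) by (simp add: isCont_def)
  have lim_c: "(c \<longlongrightarrow> p j) (at 0)"
    using DERIV_isCont[OF c(1)] c(2) by (simp add: isCont_def)
  have ev: "\<forall>\<^sub>F t in at 0. (\<forall>k\<in>{..<m}. \<bar>y t k - p k\<bar> < e) \<and> \<bar>c t - p j\<bar> < e"
    using lim_y lim_c e(1)
    by (intro eventually_conj eventually_ball_finite) (auto simp: tendsto_iff dist_real_def)
  define good where "good t s \<longleftrightarrow> \<bar>s - p j\<bar> \<le> \<bar>c t - p j\<bar> \<and> (y t)(j := s) \<in> V \<and>
      g ((y t)(j := c t)) - g ((y t)(j := p j)) = partial j g ((y t)(j := s)) * (c t - p j)" for t s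
  \<comment> \<open>A mean value point exists only for small \<open>t\<close>. The default
    \<open>p j\<close> makes the bound \<open>z_le\<close> true for every \<open>t\<close>, so
    \<open>z\<close> is squeezed to \<open>p j\<close>.\<close>
  define z where "z t = (if \<exists>s. good t s then SOME s. good t s else p j)" for t
  have good: "\<forall>\<^sub>F t in at 0. good t (z t)"
    using ev
  proof eventually_elim
    case (elim t)
    have inV: "(y t)(j := s) \<in> V" if "\<bar>s - p j\<bar> \<le> \<bar>c t - p j\<bar>" for s
      using elim that y(1)[of t] V(2) by (intro e(2)) (auto simp: Rn_def)
    have "\<exists>s. \<bar>s - p j\<bar> \<le> \<bar>c t - p j\<bar> \<and>
        g ((y t)(j := c t)) - g ((y t)(j := p j)) = partial j g ((y t)(j := s)) * (c t - p j)"
      using inV diff by (intro MVT_unordered has_partial_shift) blast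
    then have "\<exists>s. good t s" using inV by (auto simp: good_def)
    then show ?case by (simp add: z_def someI_ex)
  qed
  have z_le: "\<bar>z t - p j\<bar> \<le> \<bar>c t - p j\<bar>" for t
    using someI_ex[of "good t"] by (auto simp: z_def good_def)
  have "((\<lambda>t. \<bar>c t - p j\<bar>) \<longlongrightarrow> 0) (at 0)"
    using tendsto_rabs[OF tendsto_diff[OF lim_c tendsto_const[of "p j"]]] by simp
  then have "((\<lambda>t. z t - p j) \<longlongrightarrow> 0) (at 0)"
    by (rule tendsto_0_le[where K = 1]) (simp add: z_le)
  then have lim_z: "(z \<longlongrightarrow> p j) (at 0)" by (simp add: LIM_zero_cancel)
  have "((\<lambda>t. (y t)(j := z t)) \<longlongrightarrow> p) (at 0)"
  proof (rule tendsto_coordinatewise)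
    show "((\<lambda>t. ((y t)(j := z t)) i) \<longlongrightarrow> p i) (at 0)" for i
      by (cases "i = j") (use lim_y lim_z in auto)
  qed
  then have "((\<lambda>t. partial j g ((y t)(j := z t))) \<longlongrightarrow> partial j g p) (at 0)"
    using cont y(4) good by (auto elim!: continuous_on_tendsto_compose eventually_mono simp: good_def)
  moreover have "((\<lambda>t. (c t - p j) / t) \<longlongrightarrow> c') (at 0)"
    using c by (simp add: has_field_derivative_iff)
  ultimately have "((\<lambda>t. partial j g ((y t)(j := z t)) * ((c t - p j) / t)) \<longlongrightarrow> partial j g p * c') (at 0)"
    by (rule tendsto_mult)
  moreover have "\<forall>\<^sub>F t in at 0. partial j g ((y t)(j := z t)) * ((c t - p j) / t)
      = (g ((y t)(j := c t)) - g ((y t)(j := p j))) / t"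
    using good by eventually_elim (simp add: good_def)
  ultimately have "((\<lambda>t. (g ((y t)(j := c t)) - g ((y t)(j := p j))) / t) \<longlongrightarrow> partial j g p * c') (at 0)"
    by (rule Lim_transform_eventually)
  then show ?thesis using c(2) by (simp add: has_field_derivative_iff)
qed

lemma curve_chain_rule:
  assumes V: "open_Rn m V"
    and diff: "\<And>j x. j < m \<Longrightarrow> x \<in> V \<Longrightarrow> has_partial j g x (partial j g x)"
    and cont: "\<And>j. j < m \<Longrightarrow> continuous_on V (partial j g)"
    and \<gamma>: "\<And>j. j < m \<Longrightarrow> ((\<lambda>t. \<gamma> t j) has_real_derivative \<gamma>' j) (at 0)"
    and in_V: "\<gamma> 0 \<in> V" and ev: "\<forall>\<^sub>F t in nhds 0. \<gamma> t \<in> Rn m"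
  shows "((\<lambda>t. g (\<gamma> t)) has_real_derivative (\<Sum>j<m. partial j g (\<gamma> 0) * \<gamma>' j)) (at 0)"
proof -
  have 0: "\<gamma> 0 \<in> Rn m" using V in_V open_Rn_subset by blast
  \<comment> \<open>A staircase from the constant \<open>\<gamma> 0\<close> to
    \<open>\<gamma>\<close>: passing from \<open>h l\<close> to \<open>h (Suc l)\<close> moves slot
    \<open>l\<close> alone. At \<open>l = m\<close> it is \<open>\<gamma>\<close> itself wherever
    \<open>\<gamma> t\<close> lies in \<open>Rn m\<close>, since all later coordinates are
    0.\<close>
  define h where "h l t = (\<lambda>k. if k < l then \<gamma> t k else \<gamma> 0 k)" for l t
  have "((\<lambda>t. g (h l t)) has_real_derivative (\<Sum>j<l. partial j g (\<gamma> 0) * \<gamma>' j)) (at 0)"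
    if "l \<le> m" for l
    using that
  proof (induction l)
    case 0
    then show ?case by (simp add: h_def)
  next
    case (Suc l)
    have l: "l < m" using Suc.prems by simp
    have "((\<lambda>t. g ((h l t)(l := \<gamma> t l)) - g ((h l t)(l := \<gamma> 0 l))) has_real_derivative
        partial l g (\<gamma> 0) * \<gamma>' l) (at 0)"
    proof (rule slot_derivative[OF V l])
      show "h l t \<in> Rn m" for t using 0 l by (auto simp: h_def Rn_def)
      show "isCont (\<lambda>t. h l t k) 0" for k
        using DERIV_isCont[OF \<gamma>] l by (cases "k < l") (auto simp: h_def)
    qed (use diff cont \<gamma> l in_V in \<open>auto simp: h_def\<close>)
    from DERIV_add[OF Suc.IH this]
    have "((\<lambda>t. g (h l t) + (g ((h l t)(l := \<gamma> t l)) - g ((h l t)(l := \<gamma> 0 l)))) has_real_derivative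
        (\<Sum>j<Suc l. partial j g (\<gamma> 0) * \<gamma>' j)) (at 0)"
      using l by simp
    moreover have "(h l t)(l := \<gamma> t l) = h (Suc l) t" "(h l t)(l := \<gamma> 0 l) = h l t" for t
      by (auto simp: h_def less_Suc_eq)
    ultimately show ?case by simp
  qed
  then have "((\<lambda>t. g (h m t)) has_real_derivative (\<Sum>j<m. partial j g (\<gamma> 0) * \<gamma>' j)) (at 0)" by simp
  moreover have "\<forall>\<^sub>F t in nhds 0. g (h m t) = g (\<gamma> t)"
    using ev
  proof eventually_elim
    case (elim t)
    then have "h m t = \<gamma> t" using 0 by (auto simp: h_def Rn_def)
    then show ?case by simp
  qed
  ultimately show ?thesis by (simp add: DERIV_cong_ev)
qed

text \<open>The recursion peels off the innermost derivative, while \<open>iter_partial\<close> adds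
  the outermost one. In this form an induction on the order differentiates once and applies its
  hypothesis to the partial derivatives.\<close>

fun Ck :: "nat \<Rightarrow> vec set \<Rightarrow> nat \<Rightarrow> (vec \<Rightarrow> real) \<Rightarrow> bool" where
  "Ck m V 0 g \<longleftrightarrow> continuous_on V g"
| "Ck m V (Suc k) g \<longleftrightarrow> continuous_on V g \<and>
     (\<forall>i<m. (\<forall>x\<in>V. has_partial i g x (partial i g x)) \<and> Ck m V k (partial i g))"

lemma iter_partial_snoc: "iter_partial (is @ [i]) g = iter_partial is (partial i g)"
  by (induction "is") auto

text \<open>The last entry of an index list is the first derivative taken, so splitting lists at the
  end matches the recursion of \<open>Ck\<close>.\<close>

lemma Ck_iff:
  "Ck m V k g \<longleftrightarrow> (\<forall>is. set is \<subseteq> {..<m} \<longrightarrow>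
     (length is \<le> k \<longrightarrow> continuous_on V (iter_partial is g)) \<and>
     (length is < k \<longrightarrow> (\<forall>i<m. \<forall>x\<in>V. has_partial i (iter_partial is g) x (partial i (iter_partial is g) x))))"
  (is "_ \<longleftrightarrow> (\<forall>is. ?P k g is)")
proof (induction k arbitrary: g)
  case 0
  then show ?case by simp
next
  case (Suc k)
  have snoc: "?P (Suc k) g (is @ [i]) \<longleftrightarrow> i < m \<longrightarrow> ?P k (partial i g) is" for "is" i
    by (auto simp: iter_partial_snoc)
  have all_snoc: "(\<forall>is. P is) \<longleftrightarrow> P [] \<and> (\<forall>is i. P (is @ [i]))" for P :: "nat list \<Rightarrow> bool"
    by (metis rev_exhaust)
  have "(\<forall>is. ?P (Suc k) g is) \<longleftrightarrow> ?P (Suc k) g [] \<and> (\<forall>is i. ?P (Suc k) g (is @ [i]))"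
    by (rule all_snoc)
  also have "\<dots> \<longleftrightarrow> ?P (Suc k) g [] \<and> (\<forall>i<m. Ck m V k (partial i g))"
    unfolding snoc Suc.IH by blast
  also have "\<dots> \<longleftrightarrow> Ck m V (Suc k) g" by auto
  finally show ?case ..
qed

lemma smooth_fn_iff_Ck: "smooth_fn m V g \<longleftrightarrow> open_Rn m V \<and> (\<forall>k. Ck m V k g)"
proof -
  have "(\<forall>k. Ck m V k g) \<longleftrightarrow> (\<forall>is. set is \<subseteq> {..<m} \<longrightarrow> continuous_on V (iter_partial is g) \<and>
      (\<forall>i<m. \<forall>x\<in>V. has_partial i (iter_partial is g) x (partial i (iter_partial is g) x)))"
    (is "?L \<longleftrightarrow> ?R")
  proof
    assume L: ?L
    show ?R
    proof (intro allI impI)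
      fix "is" assume "set is \<subseteq> {..<m}"
      \<comment> \<open>One order above the length of the list gives both the continuity of the
        iterated derivative and the existence of its own partials.\<close>
      then show "continuous_on V (iter_partial is g) \<and>
          (\<forall>i<m. \<forall>x\<in>V. has_partial i (iter_partial is g) x (partial i (iter_partial is g) x))"
        using L[rule_format, of "Suc (length is)", unfolded Ck_iff] by simp
    qed
  qed (auto simp: Ck_iff)
  then show ?thesis by (simp add: smooth_fn_def differentiable_iff_has_partial)
qed

lemma Ck_Suc_D: "Ck m V (Suc k) g \<Longrightarrow> Ck m V k g"
proof (induction k arbitrary: g)
  case (Suc k)
  have "Ck m V k (partial i g)" if "i < m" for i
    using Suc.prems that by (intro Suc.IH) (subst (asm) Ck.simps(2), blast)
  moreover have "continuous_on V g" "\<forall>i<m. \<forall>x\<in>V. has_partial i g x (partial i g x)"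
    using Suc.prems by (subst (asm) Ck.simps(2), blast)+
  ultimately show ?case by simp
qed simp

lemma Ck_cont: "Ck m V k g \<Longrightarrow> continuous_on V g"
  by (cases k) auto

text \<open>Short pieces of the coordinate line through a point of an open set stay inside
  it.\<close>

lemma has_partial_cong:
  assumes "open_Rn m V" "\<And>x. x \<in> V \<Longrightarrow> g x = g' x" "x \<in> V" "i < m"
  shows "has_partial i g x d \<longleftrightarrow> has_partial i g' x d"
  unfolding has_partial_def
proof (rule DERIV_cong_ev)
  show "\<forall>\<^sub>F t in nhds 0. g (x(i := x i + t)) = g' (x(i := x i + t))"
    using eventually_line_in[OF assms(1,3,4)] by eventually_elim (simp only: assms(2))
qed auto

text \<open>The candidates \<open>g'\<close> agree with the partials on \<open>V\<close> only, so
  invariance of \<open>Ck\<close> under such changes is required. It is a premise here because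
  \<open>Ck_cong\<close> is proved through this rule and supplies its induction hypothesis;
  \<open>Ck_SucI\<close> discharges it afterwards.\<close>

lemma Ck_SucI_cong:
  assumes V: "open_Rn m V" and "continuous_on V g"
    and d: "\<And>i x. i < m \<Longrightarrow> x \<in> V \<Longrightarrow> has_partial i g x (g' i x)"
    and k: "\<And>i. i < m \<Longrightarrow> Ck m V k (g' i)"
    and cong: "\<And>h h'. (\<And>x. x \<in> V \<Longrightarrow> h x = h' x) \<Longrightarrow> Ck m V k h \<Longrightarrow> Ck m V k h'"
  shows "Ck m V (Suc k) g"
proof -
  have eq: "partial i g x = g' i x" if "i < m" "x \<in> V" for i x
    using d[OF that] by (rule has_partialD)
  then have "Ck m V k (partial i g)" if "i < m" for i
    using that by (intro cong[OF _ k]) auto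
  then show ?thesis using assms(2) d eq by auto
qed

lemma Ck_cong:
  assumes "open_Rn m V" "\<And>x. x \<in> V \<Longrightarrow> g x = g' x" "Ck m V k g"
  shows "Ck m V k g'"
  using assms(2,3)
proof (induction k arbitrary: g g')
  case 0
  then show ?case by (simp cong: continuous_on_cong)
next
  case (Suc k)
  have "has_partial i g' x (partial i g x)" if "i < m" "x \<in> V" for i x
    using Suc.prems that has_partial_cong[OF assms(1), of g g'] by auto
  moreover have "continuous_on V g'" using Suc.prems by (simp cong: continuous_on_cong)
  ultimately show ?case
    using Suc.prems(2) by (intro Ck_SucI_cong[OF assms(1) _ _ _ Suc.IH, where g' = "\<lambda>i. partial i g"]) simp_all
qed

lemma Ck_SucI:
  assumes V: "open_Rn m V" and "continuous_on V g"
    and "\<And>i x. i < m \<Longrightarrow> x \<in> V \<Longrightarrow> has_partial i g x (g' i x)"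
    and "\<And>i. i < m \<Longrightarrow> Ck m V k (g' i)"
  shows "Ck m V (Suc k) g"
  using assms Ck_cong[OF V] by (rule Ck_SucI_cong)

lemma Ck_const: "open_Rn m V \<Longrightarrow> Ck m V k (\<lambda>_. c)"
proof (induction k arbitrary: c)
  case (Suc k)
  show ?case
    by (rule Ck_SucI[where g' = "\<lambda>_ _. 0"]) (use Suc in \<open>auto simp: has_partial_def\<close>)
qed auto

lemma has_partial_coord: "has_partial i (\<lambda>x. x j) x (if i = j then 1 else 0)"
  by (auto simp: has_partial_def intro!: derivative_eq_intros)

lemma Ck_coord: "open_Rn m V \<Longrightarrow> Ck m V k (\<lambda>x. x j)"
proof (cases k)
  case (Suc k')
  assume V: "open_Rn m V"
  show ?thesis unfolding Suc
  proof (rule Ck_SucI[where g' = "\<lambda>i _. if i = j then 1 else 0"])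
    show "has_partial i (\<lambda>x. x j) x (if i = j then 1 else 0)" for i x
      by (rule has_partial_coord)
  qed (auto simp: V Ck_const continuous_on_subset[OF continuous_on_product_coordinates])
qed (simp add: continuous_on_subset[OF continuous_on_product_coordinates])

lemma Ck_add: "open_Rn m V \<Longrightarrow> Ck m V k g \<Longrightarrow> Ck m V k h \<Longrightarrow> Ck m V k (\<lambda>x. g x + h x)"
proof (induction k arbitrary: g h)
  case (Suc k)
  show ?case
  proof (rule Ck_SucI[where g' = "\<lambda>i x. partial i g x + partial i h x"])
    fix i x assume "i < m" "x \<in> V"
    then have "has_partial i g x (partial i g x)" "has_partial i h x (partial i h x)"
      using Suc.prems by auto
    then show "has_partial i (\<lambda>x. g x + h x) x (partial i g x + partial i h x)"
      unfolding has_partial_def by (rule DERIV_add)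
  qed (use Suc in \<open>simp_all add: continuous_on_add\<close>)
qed (simp add: continuous_on_add)

lemma Ck_mult: "open_Rn m V \<Longrightarrow> Ck m V k g \<Longrightarrow> Ck m V k h \<Longrightarrow> Ck m V k (\<lambda>x. g x * h x)"
proof (induction k arbitrary: g h)
  case (Suc k)
  have g: "Ck m V k g" and h: "Ck m V k h" using Suc.prems Ck_Suc_D by blast+
  show ?case
  proof (rule Ck_SucI[where g' = "\<lambda>i x. partial i g x * h x + partial i h x * g x"])
    fix i x assume "i < m" "x \<in> V"
    then have "has_partial i g x (partial i g x)" "has_partial i h x (partial i h x)"
      using Suc.prems by auto
    from DERIV_mult[OF this[unfolded has_partial_def]]
    show "has_partial i (\<lambda>x. g x * h x) x (partial i g x * h x + partial i h x * g x)"
      by (simp add: has_partial_def)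
  qed (use Suc g h in \<open>simp_all add: continuous_on_mult Ck_add\<close>)
qed (simp add: continuous_on_mult)

lemma Ck_sum: "open_Rn m V \<Longrightarrow> (\<And>j. j < n \<Longrightarrow> Ck m V k (g j)) \<Longrightarrow> Ck m V k (\<lambda>x. \<Sum>j<n::nat. g j x)"
  by (induction n) (simp_all add: Ck_add Ck_const)

lemma continuous_on_into_Rn:
  assumes "\<And>x. x \<in> V \<Longrightarrow> f x \<in> Rn n" "\<And>j. j < n \<Longrightarrow> continuous_on V (\<lambda>x. f x j)"
  shows "continuous_on V f"
proof (rule continuous_on_coordinatewise_then_product)
  fix j
  show "continuous_on V (\<lambda>x. f x j)"
  proof (cases "j < n")
    case False
    then have "\<And>x. x \<in> V \<Longrightarrow> f x j = 0" using assms(1) by (simp add: Rn_def)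
    then show ?thesis by (simp cong: continuous_on_cong)
  qed (use assms in auto)
qed

text \<open>By the chain rule each partial of the composite is a sum of products of partials of
  \<open>g\<close> after \<open>f\<close> with partials of the components of \<open>f\<close>. The
  former are composites again, one order lower, and fall under the induction hypothesis.\<close>

lemma Ck_compose:
  assumes W: "open_Rn l W" and V: "open_Rn m V" and f: "f ` W \<subseteq> V"
  shows "Ck m V k g \<Longrightarrow> (\<And>j. j < m \<Longrightarrow> Ck l W k (\<lambda>x. f x j)) \<Longrightarrow> Ck l W k (\<lambda>x. g (f x))"
proof (induction k arbitrary: g)
  have f_Rn: "f x \<in> Rn m" if "x \<in> W" for x using that f open_Rn_subset[OF V] by auto
  have cont: "continuous_on W (\<lambda>x. g (f x))"
    if "continuous_on V g" "\<And>j. j < m \<Longrightarrow> continuous_on W (\<lambda>x. f x j)" for g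
    using continuous_on_compose2[OF that(1) continuous_on_into_Rn[OF f_Rn that(2)] f] by simp
  { case 0
    then show ?case using cont by simp }
  case (Suc k)
  show ?case
  proof (rule Ck_SucI[OF W, where g' = "\<lambda>i x. \<Sum>j<m. partial j g (f x) * partial i (\<lambda>x. f x j) x"])
    show "continuous_on W (\<lambda>x. g (f x))" using Suc.prems Ck_cont cont by blast
    fix i assume i: "i < l"
    show "Ck l W k (\<lambda>x. \<Sum>j<m. partial j g (f x) * partial i (\<lambda>x. f x j) x)"
    proof (rule Ck_sum[OF W], rule Ck_mult[OF W])
      fix j assume j: "j < m"
      show "Ck l W k (\<lambda>x. partial j g (f x))"
      proof (rule Suc.IH)
        show "Ck m V k (partial j g)" using Suc.prems(1) j by simp
        show "Ck l W k (\<lambda>x. f x j')" if "j' < m" for j'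
          using Suc.prems(2)[OF that] by (rule Ck_Suc_D)
      qed
      show "Ck l W k (partial i (\<lambda>x. f x j))" using Suc.prems(2)[OF j] i by simp
    qed
    fix x assume x: "x \<in> W"
    \<comment> \<open>The \<open>i\<close>-th partial of the composite is the derivative of
      \<open>g\<close> along the image under \<open>f\<close> of the \<open>i\<close>-th coordinate
      line.\<close>
    define \<gamma> where "\<gamma> t = f (x(i := x i + t))" for t
    have "\<gamma> 0 = f x" by (simp add: \<gamma>_def)
    have "((\<lambda>t. g (\<gamma> t)) has_real_derivative (\<Sum>j<m. partial j g (\<gamma> 0) * partial i (\<lambda>x. f x j) x)) (at 0)"
    proof (rule curve_chain_rule[OF V])
      show "((\<lambda>t. \<gamma> t j) has_real_derivative partial i (\<lambda>x. f x j) x) (at 0)" if "j < m" for j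
        unfolding \<gamma>_def
        using Suc.prems(2)[OF that] i x by (auto simp: has_partial_def)
      show "\<forall>\<^sub>F t in nhds 0. \<gamma> t \<in> Rn m"
        using eventually_line_in[OF W x i] by eventually_elim (simp add: \<gamma>_def f_Rn)
      show "continuous_on V (partial j g)" if "j < m" for j
        using Suc.prems(1) that by (auto intro: Ck_cont)
    qed (use Suc.prems(1) x f \<open>\<gamma> 0 = f x\<close> in auto)
    then show "has_partial i (\<lambda>x. g (f x)) x (\<Sum>j<m. partial j g (f x) * partial i (\<lambda>x. f x j) x)"
      by (simp add: \<gamma>_def has_partial_def)
  qed
qed

section \<open>Smooth functions and smooth maps\<close>

lemma smooth_fn_const: "open_Rn m V \<Longrightarrow> smooth_fn m V (\<lambda>_. c)"
  and smooth_fn_coord: "open_Rn m V \<Longrightarrow> smooth_fn m V (\<lambda>x. x j)"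
  by (auto simp: smooth_fn_iff_Ck Ck_const Ck_coord)

lemma smooth_fn_add: "smooth_fn m V g \<Longrightarrow> smooth_fn m V h \<Longrightarrow> smooth_fn m V (\<lambda>x. g x + h x)"
  and smooth_fn_mult: "smooth_fn m V g \<Longrightarrow> smooth_fn m V h \<Longrightarrow> smooth_fn m V (\<lambda>x. g x * h x)"
  by (auto simp: smooth_fn_iff_Ck Ck_add Ck_mult)

lemma smooth_mapI:
  assumes "open_Rn m V" "\<And>x. x \<in> V \<Longrightarrow> f x \<in> Rn n" "\<And>j. j < n \<Longrightarrow> smooth_fn m V (\<lambda>x. f x j)"
  shows "smooth_map m V n f"
  using assms by (auto simp: smooth_map_def)

lemma smooth_fn_compose:
  assumes "smooth_fn m V g" "smooth_map l W m f" "f ` W \<subseteq> V"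
  shows "smooth_fn l W (\<lambda>x. g (f x))"
proof -
  have "open_Rn l W" "open_Rn m V" using assms by (auto simp: smooth_fn_iff_Ck smooth_map_def)
  then have "Ck l W k (\<lambda>x. g (f x))" for k
    by (rule Ck_compose[OF _ _ assms(3)]) (use assms in \<open>auto simp: smooth_fn_iff_Ck smooth_map_def\<close>)
  then show ?thesis using assms by (simp add: smooth_fn_iff_Ck smooth_map_def)
qed

lemma smooth_map_compose:
  assumes "smooth_map m V n g" "smooth_map l W m f" "f ` W \<subseteq> V"
  shows "smooth_map l W n (g \<circ> f)"
  using assms smooth_fn_compose[OF _ assms(2,3)] by (auto simp: smooth_map_def image_subset_iff)

lemma smooth_map_id: "open_Rn m V \<Longrightarrow> smooth_map m V m (\<lambda>x. x)"
  using open_Rn_subset by (auto intro!: smooth_mapI smooth_fn_coord)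

lemma smooth_map_const: "open_Rn m V \<Longrightarrow> c \<in> Rn n \<Longrightarrow> smooth_map m V n (\<lambda>_. c)"
  by (auto intro!: smooth_mapI smooth_fn_const)

lemma smooth_map_restrict:
  assumes "smooth_map m V n f" "open_Rn m W" "W \<subseteq> V"
  shows "smooth_map m W n f"
  using smooth_map_compose[OF assms(1) smooth_map_id[OF assms(2)]] assms(3) by (simp add: comp_def)

lemma smooth_map_continuous: "smooth_map m V n f \<Longrightarrow> continuous_on V f"
  by (rule continuous_on_into_Rn[of V f n], auto simp: smooth_map_def smooth_fn_iff_Ck)
     (metis Ck.simps(1))

section \<open>Tangent vectors of plots\<close>

lemmas fsum_defs = fsub_def fadd_def fscale_def vadd_def delta_def fzero_def zv_def

lemma zv_Rn [simp]: "zv \<in> Rn n"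
  by (simp add: zv_def Rn_def)

lemma vadd_Rn: "x \<in> Rn n \<Longrightarrow> y \<in> Rn n \<Longrightarrow> vadd x y \<in> Rn n"
  by (simp add: vadd_def Rn_def)

lemma is_fsum_fzero: "is_fsum D x fzero"
  by (auto simp: is_fsum_def fzero_def)

lemma is_fsum_fadd:
  assumes "is_fsum D x c" "is_fsum D x d"
  shows "is_fsum D x (fadd c d)"
proof -
  have sub: "{P. fadd c d P \<noteq> zv} \<subseteq> {P. c P \<noteq> zv} \<union> {P. d P \<noteq> zv}"
    by (auto simp: fadd_def vadd_def zv_def)
  then have "finite {P. fadd c d P \<noteq> zv}"
    by (rule finite_subset) (use assms in \<open>simp add: is_fsum_def\<close>)
  then show ?thesis
    using assms sub unfolding is_fsum_def by (auto simp: fadd_def vadd_Rn)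
qed

lemma is_fsum_fscale:
  assumes "is_fsum D x c"
  shows "is_fsum D x (fscale r c)"
proof -
  have sub: "{P. fscale r c P \<noteq> zv} \<subseteq> {P. c P \<noteq> zv}"
    by (auto simp: fscale_def zv_def)
  then have "finite {P. fscale r c P \<noteq> zv}"
    by (rule finite_subset) (use assms in \<open>simp add: is_fsum_def\<close>)
  then show ?thesis
    using assms sub unfolding is_fsum_def by (auto simp: fscale_def Rn_def)
qed

lemma is_fsum_delta:
  assumes "pplot D x P" "v \<in> Rn (fst P)"
  shows "is_fsum D x (delta P v)"
proof -
  have "{Q. delta P v Q \<noteq> zv} \<subseteq> {P}" by (auto simp: delta_def)
  then have "finite {Q. delta P v Q \<noteq> zv}" by (rule finite_subset) simp
  then show ?thesis using assms unfolding is_fsum_def by (auto simp: delta_def)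
qed

lemma rel_fsub_refl: "fsub c c \<in> rel D x"
proof -
  have "fsub c c = fzero" by (simp add: fsum_defs)
  then show ?thesis by (simp add: rel_zero)
qed

lemma rel_fsub_sym:
  assumes "fsub c d \<in> rel D x"
  shows "fsub d c \<in> rel D x"
proof -
  have "fsub d c = fscale (-1) (fsub c d)" by (simp add: fsum_defs)
  then show ?thesis using assms by (simp add: rel_scale)
qed

lemma rel_fsub_trans:
  assumes "fsub c d \<in> rel D x" "fsub d b \<in> rel D x"
  shows "fsub c b \<in> rel D x"
proof -
  have "fsub c b = fadd (fsub c d) (fsub d b)" by (simp add: fsum_defs)
  then show ?thesis using assms by (simp add: rel_add)
qed

lemma tcls_eqI:
  assumes "fsub c d \<in> rel D x"
  shows "tcls D x c = tcls D x d"
proof -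
  have "fsub c c' \<in> rel D x \<longleftrightarrow> fsub d c' \<in> rel D x" for c'
    using rel_fsub_trans[OF assms] rel_fsub_trans[OF rel_fsub_sym[OF assms]] by auto
  then show ?thesis by (simp add: tcls_def)
qed

text \<open>\<open>tadd\<close> and \<open>tscale\<close> compute with representatives picked by
  \<open>SOME\<close>. These differ from any given representative by an element of
  \<open>rel\<close>, which makes both operations well defined.\<close>

lemma some_in_tcls:
  assumes "is_fsum D x c"
  shows "is_fsum D x (SOME c'. c' \<in> tcls D x c)" "fsub c (SOME c'. c' \<in> tcls D x c) \<in> rel D x"
proof -
  have "c \<in> tcls D x c" using assms by (simp add: tcls_def rel_fsub_refl)
  then have "(SOME c'. c' \<in> tcls D x c) \<in> tcls D x c" by (rule someI[where P = "\<lambda>c'. c' \<in> tcls D x c"])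
  then show "is_fsum D x (SOME c'. c' \<in> tcls D x c)" "fsub c (SOME c'. c' \<in> tcls D x c) \<in> rel D x"
    by (simp_all add: tcls_def)
qed

lemma tadd_tcls:
  assumes "is_fsum D x c" "is_fsum D x d"
  shows "tadd D x (tcls D x c) (tcls D x d) = tcls D x (fadd c d)"
proof -
  let ?c = "SOME c'. c' \<in> tcls D x c" and ?d = "SOME d'. d' \<in> tcls D x d"
  have "fsub (fadd c d) (fadd ?c ?d) = fadd (fsub c ?c) (fsub d ?d)"
    by (simp add: fsum_defs algebra_simps)
  then have "fsub (fadd c d) (fadd ?c ?d) \<in> rel D x"
    using some_in_tcls[OF assms(1)] some_in_tcls[OF assms(2)] by (simp add: rel_add)
  then show ?thesis unfolding tadd_def by (rule tcls_eqI[OF rel_fsub_sym])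
qed

lemma tscale_tcls:
  assumes "is_fsum D x c"
  shows "tscale D x r (tcls D x c) = tcls D x (fscale r c)"
proof -
  let ?c = "SOME c'. c' \<in> tcls D x c"
  have "fsub (fscale r c) (fscale r ?c) = fscale r (fsub c ?c)"
    by (simp add: fsum_defs algebra_simps)
  then have "fsub (fscale r c) (fscale r ?c) \<in> rel D x"
    using some_in_tcls[OF assms] by (simp add: rel_scale)
  then show ?thesis unfolding tscale_def by (rule tcls_eqI[OF rel_fsub_sym])
qed

lemma TspaceI: "is_fsum D x c \<Longrightarrow> tcls D x c \<in> Tspace D x"
  by (simp add: Tspace_def)

lemma TspaceE:
  assumes "t \<in> Tspace D x"
  obtains c where "is_fsum D x c" "t = tcls D x c"
  using assms by (auto simp: Tspace_def)

lemma Tspace_tadd: "s \<in> Tspace D x \<Longrightarrow> t \<in> Tspace D x \<Longrightarrow> tadd D x s t \<in> Tspace D x"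
  by (elim TspaceE) (simp add: TspaceI is_fsum_fadd tadd_tcls)

lemma Tspace_tscale: "t \<in> Tspace D x \<Longrightarrow> tscale D x r t \<in> Tspace D x"
  by (elim TspaceE) (simp add: TspaceI is_fsum_fscale tscale_tcls)

lemma Tspace_tzero: "tzero D x \<in> Tspace D x"
  by (simp add: tzero_def TspaceI is_fsum_fzero)

lemma Tfib_eq: "x \<in> X \<Longrightarrow> Tfib X D x = {x} \<times> Tspace D x"
  by (auto simp: Tfib_def TB_def)

text \<open>Each identity between formal sums passes to classes through \<open>tadd_tcls\<close> and
  \<open>tscale_tcls\<close>; the negative of a class is its multiple by -1.\<close>

lemma fibre_vs_Tfib:
  assumes "x \<in> X"
  shows "fibre_vs (Tfib X D x) (tbadd D) (tbscale D) (tbzero D x)"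
proof -
  have ex: "\<exists>b\<in>Tspace D x. tadd D x a b = tzero D x" if a: "a \<in> Tspace D x" for a
  proof -
    obtain c where c: "is_fsum D x c" "a = tcls D x c" using a by (rule TspaceE)
    have "fadd c (fscale (-1) c) = fzero" by (simp add: fsum_defs)
    then have "tadd D x a (tcls D x (fscale (-1) c)) = tzero D x"
      using c by (simp add: tadd_tcls is_fsum_fscale tzero_def)
    then show ?thesis using c by (auto intro: TspaceI is_fsum_fscale)
  qed
  note simps = tadd_tcls tscale_tcls is_fsum_fadd is_fsum_fscale is_fsum_fzero tzero_def
  have assoc: "tadd D x (tadd D x a b) c = tadd D x a (tadd D x b c)"
    if "a \<in> Tspace D x" "b \<in> Tspace D x" "c \<in> Tspace D x" for a b c
  proof -
    have "fadd (fadd a b) c = fadd a (fadd b c)" for a b c :: "'a fsum" by (simp add: fsum_defs add.assoc)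
    then show ?thesis using that by (elim TspaceE) (simp add: simps)
  qed
  have comm: "tadd D x a b = tadd D x b a" if "a \<in> Tspace D x" "b \<in> Tspace D x" for a b
  proof -
    have "fadd a b = fadd b a" for a b :: "'a fsum" by (simp add: fsum_defs add.commute)
    then show ?thesis using that by (elim TspaceE) (simp add: simps)
  qed
  have zero: "tadd D x (tzero D x) a = a" if "a \<in> Tspace D x" for a
  proof -
    have "fadd fzero a = a" for a :: "'a fsum" by (simp add: fsum_defs)
    then show ?thesis using that by (elim TspaceE) (simp add: simps)
  qed
  have distr: "tscale D x r (tadd D x a b) = tadd D x (tscale D x r a) (tscale D x r b)"
    if "a \<in> Tspace D x" "b \<in> Tspace D x" for r a b
  proof -
    have "fscale r (fadd a b) = fadd (fscale r a) (fscale r b)" for a b :: "'a fsum"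
      by (simp add: fsum_defs distrib_left)
    then show ?thesis using that by (elim TspaceE) (simp add: simps)
  qed
  have distr': "tscale D x (r + s) a = tadd D x (tscale D x r a) (tscale D x s a)"
    if "a \<in> Tspace D x" for r s a
  proof -
    have "fscale (r + s) a = fadd (fscale r a) (fscale s a)" for a :: "'a fsum"
      by (simp add: fsum_defs distrib_right)
    then show ?thesis using that by (elim TspaceE) (simp add: simps)
  qed
  have mult: "tscale D x r (tscale D x s a) = tscale D x (r * s) a" if "a \<in> Tspace D x" for r s a
  proof -
    have "fscale r (fscale s a) = fscale (r * s) a" for a :: "'a fsum" by (simp add: fsum_defs mult.assoc)
    then show ?thesis using that by (elim TspaceE) (simp add: simps)
  qed
  have one: "tscale D x 1 a = a" if "a \<in> Tspace D x" for a
  proof -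
    have "fscale 1 a = a" for a :: "'a fsum" by (simp add: fsum_defs)
    then show ?thesis using that by (elim TspaceE) (simp add: simps)
  qed
  show ?thesis
    unfolding fibre_vs_def Tfib_eq[OF assms]
    using ex assoc comm zero distr distr' mult one
    by (auto simp: tbadd_def tbscale_def tbzero_def Tspace_tadd Tspace_tscale Tspace_tzero)
qed

text \<open>The inclusion of R^n as the block of coordinates starting at slot \<open>s\<close>.
  Being linear it is its own Jacobian, which spares any further computation of derivatives in the
  colimit.\<close>

definition inc :: "nat \<Rightarrow> nat \<Rightarrow> vec \<Rightarrow> vec" where
  "inc s n x = (\<lambda>k. if s \<le> k \<and> k < s + n then x (k - s) else 0)"

lemma inc_Rn: "s + n \<le> m \<Longrightarrow> inc s n x \<in> Rn m"
  by (auto simp: inc_def Rn_def)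

lemma inc_zv: "inc s n zv = zv"
  by (auto simp: inc_def zv_def)

lemma smooth_map_inc:
  assumes "open_Rn n U" "s + n \<le> m"
  shows "smooth_map n U m (inc s n)"
proof (rule smooth_mapI[OF assms(1) inc_Rn[OF assms(2)]])
  show "smooth_fn n U (\<lambda>x. inc s n x k)" for k
    by (cases "s \<le> k \<and> k < s + n")
       (auto simp: inc_def smooth_fn_const[OF assms(1)] smooth_fn_coord[OF assms(1)])
qed

lemma jac0_inc:
  assumes "s + n \<le> m"
  shows "jac0 n m (inc s n) v = inc s n v"
proof
  fix k
  have zero: "partial i (\<lambda>x. 0) zv = 0" for i by (simp add: partial_def)
  have coord: "partial i (\<lambda>x. x l) zv = (if i = l then 1 else 0)" for i l
    by (rule has_partialD[OF has_partial_coord])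
  show "jac0 n m (inc s n) v k = inc s n v k"
  proof (cases "s \<le> k \<and> k < s + n")
    case True
    then have "(\<Sum>i<n. partial i (\<lambda>x. x (k - s)) zv * v i) = (\<Sum>i<n. if i = k - s then v i else 0)"
      by (intro sum.cong) (auto simp: coord)
    also have "\<dots> = v (k - s)" using True by auto
    finally show ?thesis using True assms by (simp add: jac0_def inc_def)
  qed (auto simp: jac0_def inc_def zero)
qed

text \<open>The inclusion is a morphism of pointed plots, so a single generator of
  \<open>rel\<close> gives the equality.\<close>

lemma tcls_delta_inc:
  assumes "pplot D x (n, U, p)" "pplot D x (m, V, q)" "open_Rn n U" "s + n \<le> m" "v \<in> Rn n"
    and "\<And>u. u \<in> U \<Longrightarrow> inc s n u \<in> V \<and> q (inc s n u) = p u"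
  shows "tcls D x (delta (n, U, p) v) = tcls D x (delta (m, V, q) (inc s n v))"
proof -
  have "pmor (n, U, p) (m, V, q) (inc s n)"
    using assms by (auto simp: pmor_def smooth_map_inc inc_zv)
  from rel_gen[OF assms(1,2) this assms(5)] show ?thesis
    by (intro tcls_eqI) (simp add: jac0_inc assms(4))
qed

section \<open>Plots, their translates and their tangent vectors\<close>

lemma
  assumes "diffeology X D"
  shows diffeology_open: "D n U p \<Longrightarrow> open_Rn n U"
    and diffeology_mem: "D n U p \<Longrightarrow> u \<in> U \<Longrightarrow> p u \<in> X"
    and diffeology_cong: "D n U p \<Longrightarrow> (\<And>u. u \<in> U \<Longrightarrow> p u = q u) \<Longrightarrow> D n U q"
    and diffeology_const: "open_Rn n U \<Longrightarrow> x \<in> X \<Longrightarrow> D n U (\<lambda>_. x)"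
    and diffeology_compose: "D n U p \<Longrightarrow> smooth_map m V n f \<Longrightarrow> f ` V \<subseteq> U \<Longrightarrow> D m V (\<lambda>z. p (f z))"
    and diffeology_sheaf: "open_Rn n U \<Longrightarrow>
      (\<And>u. u \<in> U \<Longrightarrow> \<exists>W. open_Rn n W \<and> u \<in> W \<and> W \<subseteq> U \<and> D n W p) \<Longrightarrow> D n U p"
proof -
  note ax = assms[unfolded diffeology_def]
  note ax1 = conjunct1[OF ax] and ax2 = conjunct1[OF conjunct2[OF ax]]
    and ax3 = conjunct1[OF conjunct2[OF conjunct2[OF ax]]]
    and ax4 = conjunct1[OF conjunct2[OF conjunct2[OF conjunct2[OF ax]]]]
    and ax5 = conjunct2[OF conjunct2[OF conjunct2[OF conjunct2[OF ax]]]]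
  show "D n U p \<Longrightarrow> open_Rn n U" using ax1 by blast
  show "D n U p \<Longrightarrow> u \<in> U \<Longrightarrow> p u \<in> X" using ax1 by blast
  show "open_Rn n U \<Longrightarrow> x \<in> X \<Longrightarrow> D n U (\<lambda>_. x)" using ax3 by simp
  show "D n U p \<Longrightarrow> (\<And>u. u \<in> U \<Longrightarrow> p u = q u) \<Longrightarrow> D n U q"
    using ax2[rule_format, of n U p q] by simp
  show "D n U p \<Longrightarrow> smooth_map m V n f \<Longrightarrow> f ` V \<subseteq> U \<Longrightarrow> D m V (\<lambda>z. p (f z))"
    using ax4[rule_format, of n U p m V f] by (simp add: comp_def)
  assume U: "open_Rn n U"
    and loc: "\<And>u. u \<in> U \<Longrightarrow> \<exists>W. open_Rn n W \<and> u \<in> W \<and> W \<subseteq> U \<and> D n W p"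
  have "p ` U \<subseteq> X" using loc ax1 by blast
  with U show "D n U p" by (rule ax5[rule_format]) (rule loc)
qed

lemma diffeology_restrict:
  assumes "diffeology X D" "D n U p" "open_Rn n W" "W \<subseteq> U"
  shows "D n W p"
  using diffeology_compose[OF assms(1), OF assms(2) smooth_map_id[OF assms(3)]] assms(4) by simp

definition shift :: "nat \<Rightarrow> vec set \<Rightarrow> vec \<Rightarrow> vec set" where
  "shift n U u = {z \<in> Rn n. vadd z u \<in> U}"

definition splot :: "nat \<Rightarrow> vec set \<Rightarrow> (vec \<Rightarrow> 'a) \<Rightarrow> vec \<Rightarrow> 'a pidx" where
  "splot n U f u = (n, shift n U u, \<lambda>z. f (vadd z u))"

text \<open>Base point and velocity are separate arguments, whereas \<open>Tplot\<close> packs them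
  into one vector of R^(2n); \<open>Tplot_eq\<close> connects the two.\<close>

definition tang :: "'a diffeo \<Rightarrow> nat \<Rightarrow> vec set \<Rightarrow> (vec \<Rightarrow> 'a) \<Rightarrow> vec \<Rightarrow> vec \<Rightarrow> 'a tvec" where
  "tang D n U f u v = tcls D (f u) (delta (splot n U f u) v)"

lemma Tplot_eq: "Tplot D n U f w = (f (fstpart n w), tang D n U f (fstpart n w) (sndpart n w))"
  by (simp add: Tplot_def tang_def splot_def shift_def Let_def)

lemma smooth_map_translate:
  assumes "open_Rn n U" "u \<in> Rn n"
  shows "smooth_map n U n (\<lambda>z. vadd z u)"
proof (rule smooth_mapI[OF assms(1)])
  show "vadd x u \<in> Rn n" if "x \<in> U" for x
    using open_Rn_subset[OF assms(1)] assms(2) that by (intro vadd_Rn) auto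
  show "smooth_fn n U (\<lambda>x. vadd x u j)" for j
    unfolding vadd_def
    by (rule smooth_fn_add[OF smooth_fn_coord[OF assms(1)] smooth_fn_const[OF assms(1)]])
qed

lemma open_shift: "open_Rn n U \<Longrightarrow> u \<in> Rn n \<Longrightarrow> open_Rn n (shift n U u)"
  unfolding shift_def
  by (rule open_Rn_vimage[OF _ open_Rn_whole smooth_map_continuous[OF smooth_map_translate[OF open_Rn_whole]]])
     (auto intro: vadd_Rn)

lemma connected_shift:
  assumes "connected U" "U \<subseteq> Rn n" "u \<in> Rn n"
  shows "connected (shift n U u)"
proof -
  have "shift n U u = (\<lambda>z i. z i - u i) ` U"
  proof (intro equalityI subsetI)
    fix z assume z: "z \<in> shift n U u"
    then show "z \<in> (\<lambda>z i. z i - u i) ` U"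
      by (intro image_eqI[of _ _ "vadd z u"]) (auto simp: shift_def vadd_def)
  next
    fix z assume "z \<in> (\<lambda>z i. z i - u i) ` U"
    then show "z \<in> shift n U u" using assms by (auto simp: shift_def vadd_def Rn_def)
  qed
  moreover have "continuous_on U (\<lambda>z i. z i - u i)"
    by (intro continuous_on_coordinatewise_then_product continuous_on_diff
        continuous_on_subset[OF continuous_on_product_coordinates]) auto
  ultimately show ?thesis using assms(1) by (simp add: connected_continuous_image)
qed

locale diffeological_space =
  fixes X :: "'a set" and D :: "'a diffeo"
  assumes diffeology: "diffeology X D"
begin

lemmas D_open = diffeology_open[OF diffeology]
  and D_mem = diffeology_mem[OF diffeology]
  and D_cong = diffeology_cong[OF diffeology]
  and D_const = diffeology_const[OF diffeology]
  and D_compose = diffeology_compose[OF diffeology]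
  and D_restrict = diffeology_restrict[OF diffeology]

lemma pplot_splot:
  assumes "D n U f" "connected U" "u \<in> U"
  shows "pplot D (f u) (splot n U f u)"
proof -
  have U: "open_Rn n U" "U \<subseteq> Rn n" using D_open[OF assms(1)] open_Rn_subset by blast+
  then have u: "u \<in> Rn n" using assms by blast
  have "smooth_map n (shift n U u) n (\<lambda>z. vadd z u)"
    by (rule smooth_map_translate[OF open_shift[OF U(1) u] u])
  moreover have "(\<lambda>z. vadd z u) ` shift n U u \<subseteq> U" by (auto simp: shift_def)
  ultimately have "D n (shift n U u) (\<lambda>z. f (vadd z u))"
    by (rule D_compose[OF assms(1)])
  moreover have "vadd zv u = u" by (simp add: vadd_def zv_def)
  ultimately show ?thesis
    using connected_shift[OF assms(2) U(2) u] assms(3) by (simp add: pplot_def splot_def) (simp add: shift_def)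
qed

lemma is_fsum_splot:
  assumes "D n U f" "connected U" "u \<in> U" "v \<in> Rn n"
  shows "is_fsum D (f u) (delta (splot n U f u) v)"
  using assms by (intro is_fsum_delta pplot_splot) (auto simp: splot_def)

lemma tang_Tspace:
  assumes "D n U f" "connected U" "u \<in> U" "v \<in> Rn n"
  shows "tang D n U f u v \<in> Tspace D (f u)"
  unfolding tang_def by (intro TspaceI is_fsum_splot[OF assms])

text \<open>Both deltas sit at the same index, so the sum is taken inside one summand R^n. This is
  why bringing two vectors onto a common plot and base point computes their sum.\<close>

lemma tang_add:
  assumes "D n U f" "connected U" "u \<in> U" "v \<in> Rn n" "w \<in> Rn n"
  shows "tadd D (f u) (tang D n U f u v) (tang D n U f u w) = tang D n U f u (vadd v w)"
proof -
  have "fadd (delta P v) (delta P w) = delta P (vadd v w)" for P :: "'a pidx"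
    by (intro ext) (simp add: fsum_defs)
  then show ?thesis
    unfolding tang_def
    using tadd_tcls[OF is_fsum_splot[OF assms(1-4)] is_fsum_splot[OF assms(1-3,5)]] by simp
qed

lemma tang_scale:
  assumes "D n U f" "connected U" "u \<in> U" "v \<in> Rn n"
  shows "tscale D (f u) r (tang D n U f u v) = tang D n U f u (\<lambda>i. r * v i)"
proof -
  have "fscale r (delta P v) = delta P (\<lambda>i. r * v i)" for P :: "'a pidx"
    by (intro ext) (simp add: fsum_defs)
  then show ?thesis
    unfolding tang_def using tscale_tcls[OF is_fsum_splot[OF assms]] by simp
qed

lemma tang_zero: "tang D n U f u zv = tzero D (f u)"
proof -
  have "delta P zv = fzero" for P :: "'a pidx" by (intro ext) (simp add: fsum_defs)
  then show ?thesis by (simp add: tang_def tzero_def)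
qed

text \<open>\<open>p\<close> is the slice of \<open>K\<close> through \<open>w\<close> along one
  block of coordinates, and the inclusion of the slice is a morphism. The plot \<open>p\<close> is
  arbitrary rather than of the form \<open>splot\<close>, because a left translate by
  \<open>lact\<close> is known only on its domain.\<close>

lemma tcls_delta_tang:
  assumes P: "pplot D x (n, U, p)"
    and K: "D m V K" "connected V" "w \<in> V" "K w = x" and s: "s + n \<le> m" and v: "v \<in> Rn n"
    and comp: "\<And>z. z \<in> U \<Longrightarrow> vadd (inc s n z) w \<in> V \<and> K (vadd (inc s n z) w) = p z"
  shows "tcls D x (delta (n, U, p) v) = tang D m V K w (inc s n v)"
proof -
  have "open_Rn n U" using P D_open by (auto simp: pplot_def)
  moreover have "pplot D x (m, shift m V w, \<lambda>z. K (vadd z w))"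
    using pplot_splot[OF K(1-3)] K(4) by (simp add: splot_def)
  ultimately show ?thesis
    unfolding tang_def splot_def K(4)
    using comp by (intro tcls_delta_inc[OF P _ _ s v]) (auto simp: shift_def inc_Rn[OF s])
qed

lemma tang_inc:
  assumes f: "D n U f" "connected U" "u \<in> U"
    and K: "D m V K" "connected V" "w \<in> V" and eq: "K w = f u" and s: "s + n \<le> m" and v: "v \<in> Rn n"
    and comp: "\<And>z. z \<in> Rn n \<Longrightarrow> vadd z u \<in> U \<Longrightarrow>
      vadd (inc s n z) w \<in> V \<and> K (vadd (inc s n z) w) = f (vadd z u)"
  shows "tang D n U f u v = tang D m V K w (inc s n v)"
  unfolding tang_def[of D n] splot_def
proof (rule tcls_delta_tang[OF _ K eq s v])
  show "pplot D (f u) (n, shift n U u, \<lambda>z. f (vadd z u))"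
    using pplot_splot[OF f] by (simp add: splot_def)
qed (use comp in \<open>simp add: shift_def\<close>)

end

section \<open>Concatenation of coordinate blocks and products of domains\<close>

definition pairv :: "nat \<Rightarrow> vec \<Rightarrow> vec \<Rightarrow> vec" where
  "pairv n x y = (\<lambda>i. if i < n then x i else y (i - n))"

text \<open>Unlike \<open>sndpart\<close>, this does not truncate after \<open>n\<close> entries, so
  the second block may have any length and may itself be a pair.\<close>

definition dropv :: "nat \<Rightarrow> vec \<Rightarrow> vec" where
  "dropv n w = (\<lambda>i. w (n + i))"

definition pset :: "nat \<Rightarrow> vec set \<Rightarrow> vec set \<Rightarrow> vec set" where
  "pset n U V = (\<lambda>(x, y). pairv n x y) ` (U \<times> V)"

lemma pairv_Rn: "x \<in> Rn n \<Longrightarrow> y \<in> Rn m \<Longrightarrow> pairv n x y \<in> Rn (n + m)"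
  by (auto simp: pairv_def Rn_def)

lemma fstpart_Rn: "fstpart n w \<in> Rn n"
  by (auto simp: fstpart_def Rn_def)

lemma sndpart_Rn: "sndpart n w \<in> Rn n"
  by (auto simp: sndpart_def Rn_def)

lemma dropv_Rn: "w \<in> Rn (n + m) \<Longrightarrow> dropv n w \<in> Rn m"
  by (auto simp: dropv_def Rn_def)

lemma fstpart_pairv: "x \<in> Rn n \<Longrightarrow> fstpart n (pairv n x y) = x"
  by (auto simp: fstpart_def pairv_def Rn_def)

lemma dropv_pairv [simp]: "dropv n (pairv n x y) = y"
  by (auto simp: dropv_def pairv_def)

lemma sndpart_pairv: "y \<in> Rn n \<Longrightarrow> sndpart n (pairv n x y) = y"
  by (auto simp: sndpart_def pairv_def Rn_def)

lemma pairv_fst_drop [simp]: "pairv n (fstpart n w) (dropv n w) = w"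
  by (auto simp: pairv_def fstpart_def dropv_def)

lemma pairv_mem_pset: "x \<in> U \<Longrightarrow> y \<in> V \<Longrightarrow> pairv n x y \<in> pset n U V"
  by (auto simp: pset_def)

lemma pset_eq:
  assumes "U \<subseteq> Rn n" "V \<subseteq> Rn m"
  shows "pset n U V = {w \<in> Rn (n + m). fstpart n w \<in> U \<and> dropv n w \<in> V}"
proof (intro equalityI subsetI)
  fix w assume "w \<in> {w \<in> Rn (n + m). fstpart n w \<in> U \<and> dropv n w \<in> V}"
  then show "w \<in> pset n U V" by (metis (lifting) mem_Collect_eq pairv_fst_drop pairv_mem_pset)
qed (use assms in \<open>auto simp: pset_def fstpart_pairv pairv_Rn subsetD\<close>)

lemma smooth_map_pairv:
  assumes "smooth_map l W n a" "smooth_map l W m b"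
  shows "smooth_map l W (n + m) (\<lambda>z. pairv n (a z) (b z))"
proof (rule smooth_mapI)
  show "open_Rn l W" using assms by (simp add: smooth_map_def)
  show "pairv n (a z) (b z) \<in> Rn (n + m)" if "z \<in> W" for z
    using assms that by (auto simp: smooth_map_def intro!: pairv_Rn)
  show "smooth_fn l W (\<lambda>z. pairv n (a z) (b z) j)" if "j < n + m" for j
    using assms that by (cases "j < n") (auto simp: smooth_map_def pairv_def)
qed

lemma smooth_map_fstpart: "open_Rn m U \<Longrightarrow> smooth_map m U n (fstpart n)"
  by (rule smooth_mapI) (simp_all add: fstpart_Rn, simp add: fstpart_def smooth_fn_coord)

lemma smooth_map_dropv: "open_Rn (n + m) U \<Longrightarrow> smooth_map (n + m) U m (dropv n)"
  by (rule smooth_mapI)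
     (simp_all add: dropv_Rn subsetD[OF open_Rn_subset], simp add: dropv_def smooth_fn_coord)

lemma smooth_map_sndpart: "open_Rn m U \<Longrightarrow> smooth_map m U n (sndpart n)"
  by (rule smooth_mapI) (simp_all add: sndpart_Rn, simp add: sndpart_def smooth_fn_coord)

lemma open_pset:
  assumes "open_Rn n U" "open_Rn m V"
  shows "open_Rn (n + m) (pset n U V)"
proof -
  have "open_Rn (n + m) {w \<in> Rn (n + m). fstpart n w \<in> U}"
    using assms
    by (intro open_Rn_vimage[OF _ open_Rn_whole smooth_map_continuous[OF smooth_map_fstpart[OF open_Rn_whole]]])
       (auto intro: fstpart_Rn)
  moreover have "open_Rn (n + m) {w \<in> Rn (n + m). dropv n w \<in> V}"
    using assms
    by (intro open_Rn_vimage[OF _ open_Rn_whole smooth_map_continuous[OF smooth_map_dropv[OF open_Rn_whole]]])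
       (auto intro: dropv_Rn)
  ultimately have "open_Rn (n + m) ({w \<in> Rn (n + m). fstpart n w \<in> U} \<inter> {w \<in> Rn (n + m). dropv n w \<in> V})"
    by (rule open_Rn_Int)
  moreover have "pset n U V = {w \<in> Rn (n + m). fstpart n w \<in> U} \<inter> {w \<in> Rn (n + m). dropv n w \<in> V}"
    using assms by (subst pset_eq) (auto dest: open_Rn_subset)
  ultimately show ?thesis by simp
qed

lemma connected_pset:
  assumes "connected U" "connected V"
  shows "connected (pset n U V)"
proof -
  have c: "continuous_on (U \<times> V) (\<lambda>p. fst p i)" "continuous_on (U \<times> V) (\<lambda>p. snd p i)" for i
    by (rule continuous_on_product_then_coordinatewise, intro continuous_intros)+
  have "continuous_on (U \<times> V) (\<lambda>p. pairv n (fst p) (snd p))"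
  proof (rule continuous_on_coordinatewise_then_product)
    show "continuous_on (U \<times> V) (\<lambda>p. pairv n (fst p) (snd p) i)" for i
      by (cases "i < n") (simp_all add: pairv_def c)
  qed
  then show ?thesis
    using assms unfolding pset_def case_prod_unfold
    by (intro connected_continuous_image connected_Times)
qed

context diffeological_space
begin

lemma D_fstpart:
  assumes "D n U f" "open_Rn m V"
  shows "D (n + m) (pset n U V) (\<lambda>w. f (fstpart n w))"
proof (rule D_compose[OF assms(1)])
  have U: "open_Rn n U" by (rule D_open[OF assms(1)])
  show "smooth_map (n + m) (pset n U V) n (fstpart n)"
    by (rule smooth_map_fstpart[OF open_pset[OF U assms(2)]])
  show "fstpart n ` pset n U V \<subseteq> U"
    using open_Rn_subset[OF U] by (auto simp: pset_def fstpart_pairv)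
qed

lemma D_dropv:
  assumes "D m V f" "open_Rn n U"
  shows "D (n + m) (pset n U V) (\<lambda>w. f (dropv n w))"
proof (rule D_compose[OF assms(1)])
  show "smooth_map (n + m) (pset n U V) m (dropv n)"
    by (rule smooth_map_dropv[OF open_pset[OF assms(2) D_open[OF assms(1)]]])
qed (auto simp: pset_def)

end

lemma vadd_inc_fst: "z \<in> Rn n \<Longrightarrow> vadd (inc 0 n z) (pairv n u w) = pairv n (vadd z u) w"
  by (auto simp: vadd_def inc_def pairv_def)

lemma vadd_inc_snd: "z \<in> Rn m \<Longrightarrow> vadd (inc n m z) (pairv n u w) = pairv n u (vadd z w)"
  by (auto simp: vadd_def inc_def pairv_def Rn_def)

lemma inc_snd: "v \<in> Rn m \<Longrightarrow> inc n m v = pairv n zv v"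
  by (auto simp: inc_def pairv_def zv_def Rn_def)

section \<open>Maps that locally factor through the tangent map of a plot\<close>

definition tplot_on :: "'a diffeo \<Rightarrow> nat \<Rightarrow> vec set \<Rightarrow> (vec \<Rightarrow> 'a \<times> 'a tvec) \<Rightarrow> bool" where
  "tplot_on D n W p \<longleftrightarrow> (\<exists>N V f a v. D N V f \<and> connected V \<and> smooth_map n W N a \<and> smooth_map n W N v \<and>
     a ` W \<subseteq> V \<and> (\<forall>z\<in>W. p z = (f (a z), tang D N V f (a z) (v z))))"

text \<open>On a group this is Hector's diffeology (\<open>hector_eq\<close>), in a form where each
  plot comes locally with data \<open>f\<close>, \<open>a\<close>, \<open>v\<close> on which
  addition, scaling and translation can be carried out.\<close>

definition locally_tplot :: "'a diffeo \<Rightarrow> ('a \<times> 'a tvec) diffeo" where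
  "locally_tplot D n U p \<longleftrightarrow> open_Rn n U \<and>
     (\<forall>u\<in>U. \<exists>W. open_Rn n W \<and> u \<in> W \<and> W \<subseteq> U \<and> tplot_on D n W p)"

lemma diffeologyI:
  assumes "\<And>n U p. E n U p \<Longrightarrow> open_Rn n U" "\<And>n U p u. E n U p \<Longrightarrow> u \<in> U \<Longrightarrow> p u \<in> Y"
    and "\<And>n U p q. E n U p \<Longrightarrow> (\<And>u. u \<in> U \<Longrightarrow> p u = q u) \<Longrightarrow> E n U q"
    and "\<And>n U y. open_Rn n U \<Longrightarrow> y \<in> Y \<Longrightarrow> E n U (\<lambda>_. y)"
    and "\<And>n U p m V f. E n U p \<Longrightarrow> smooth_map m V n f \<Longrightarrow> f ` V \<subseteq> U \<Longrightarrow> E m V (\<lambda>z. p (f z))"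
    and "\<And>n U p. open_Rn n U \<Longrightarrow> p ` U \<subseteq> Y \<Longrightarrow>
      (\<And>u. u \<in> U \<Longrightarrow> \<exists>W. open_Rn n W \<and> u \<in> W \<and> W \<subseteq> U \<and> E n W p) \<Longrightarrow> E n U p"
  shows "diffeology Y E"
  unfolding diffeology_def comp_def
proof (intro conjI allI impI)
  fix n U p assume p: "E n U p"
  show "open_Rn n U" by (rule assms(1)[OF p])
  show "p ` U \<subseteq> Y" using assms(2)[OF p] by blast
next
  fix n U p q assume "E n U p" "\<forall>u\<in>U. p u = q u"
  then show "E n U q" by (intro assms(3)[of n U p q]) simp_all
next
  fix n U y assume "open_Rn n U" "y \<in> Y"
  then show "E n U (\<lambda>_. y)" by (rule assms(4))
next
  fix n U p m V f assume "E n U p" "smooth_map m V n f" "f ` V \<subseteq> U"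
  then show "E m V (\<lambda>z. p (f z))" by (rule assms(5))
next
  fix n U p assume "open_Rn n U" "p ` U \<subseteq> Y"
    and "\<forall>u\<in>U. \<exists>W. open_Rn n W \<and> u \<in> W \<and> W \<subseteq> U \<and> E n W p"
  then show "E n U p" by (intro assms(6)) simp_all
qed

lemma diffeology_sub_diff:
  assumes E: "diffeology Y E" and A: "A \<subseteq> Y"
  shows "diffeology A (sub_diff E A)"
proof (rule diffeologyI)
  fix n U p assume p: "sub_diff E A n U p"
  show "open_Rn n U" using p diffeology_open[OF E] by (auto simp: sub_diff_def)
  show "p u \<in> A" if "u \<in> U" for u using p that by (auto simp: sub_diff_def)
  show "sub_diff E A n U q" if "\<And>u. u \<in> U \<Longrightarrow> p u = q u" for q
    using p that diffeology_cong[OF E, of n U p q] by (auto simp: sub_diff_def)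
  show "sub_diff E A m V (\<lambda>z. p (f z))" if "smooth_map m V n f" "f ` V \<subseteq> U" for m V f
    using p that diffeology_compose[OF E, of n U p m V f] by (auto simp: sub_diff_def)
next
  fix n U y assume "open_Rn n U" "y \<in> A"
  then show "sub_diff E A n U (\<lambda>_. y)"
    using A diffeology_const[OF E, of n U y] by (auto simp: sub_diff_def)
next
  fix n U p assume U: "open_Rn n U" "p ` U \<subseteq> A"
    and loc: "\<And>u. u \<in> U \<Longrightarrow> \<exists>W. open_Rn n W \<and> u \<in> W \<and> W \<subseteq> U \<and> sub_diff E A n W p"
  have "E n U p"
    by (rule diffeology_sheaf[OF E U(1)]) (use loc in \<open>unfold sub_diff_def, blast\<close>)
  then show "sub_diff E A n U p" using U(2) by (simp add: sub_diff_def)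
qed

lemma diffeology_prod_diff:
  assumes D: "diffeology X D" and E: "diffeology Y E"
  shows "diffeology (X \<times> Y) (prod_diff D E)"
proof (rule diffeologyI)
  fix n U p assume p: "prod_diff D E n U p"
  show "open_Rn n U" using p diffeology_open[OF D] by (auto simp: prod_diff_def)
  show "p u \<in> X \<times> Y" if "u \<in> U" for u
    using p that diffeology_mem[OF D, of n U "fst \<circ> p" u] diffeology_mem[OF E, of n U "snd \<circ> p" u]
    by (cases "p u") (simp add: prod_diff_def)
  show "prod_diff D E n U q" if "\<And>u. u \<in> U \<Longrightarrow> p u = q u" for q
    using p that diffeology_cong[OF D, of n U "fst \<circ> p" "fst \<circ> q"]
      diffeology_cong[OF E, of n U "snd \<circ> p" "snd \<circ> q"] by (simp add: prod_diff_def)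
  show "prod_diff D E m V (\<lambda>z. p (f z))" if "smooth_map m V n f" "f ` V \<subseteq> U" for m V f
    using p that diffeology_compose[OF D, of n U "fst \<circ> p" m V f]
      diffeology_compose[OF E, of n U "snd \<circ> p" m V f] by (simp add: prod_diff_def comp_def)
next
  fix n U y assume "open_Rn n U" "y \<in> X \<times> Y"
  then show "prod_diff D E n U (\<lambda>_. y)"
    using diffeology_const[OF D, of n U "fst y"] diffeology_const[OF E, of n U "snd y"]
    by (auto simp: prod_diff_def comp_def)
next
  fix n U p assume U: "open_Rn n U"
    and loc: "\<And>u. u \<in> U \<Longrightarrow> \<exists>W. open_Rn n W \<and> u \<in> W \<and> W \<subseteq> U \<and> prod_diff D E n W p"
  have "D n U (fst \<circ> p)"
    by (rule diffeology_sheaf[OF D U]) (use loc in \<open>unfold prod_diff_def, blast\<close>)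
  moreover have "E n U (snd \<circ> p)"
    by (rule diffeology_sheaf[OF E U]) (use loc in \<open>unfold prod_diff_def, blast\<close>)
  ultimately show "prod_diff D E n U p" by (simp add: prod_diff_def)
qed

lemma fibre_vs_triv:
  assumes "fibre_vs F ad sm z"
  shows "fibre_vs ({x} \<times> F) (\<lambda>a b. (fst a, ad (snd a) (snd b))) (\<lambda>r a. (fst a, sm r (snd a))) (x, z)"
  unfolding fibre_vs_def
proof (intro conjI)
  show "\<forall>a\<in>{x} \<times> F. \<exists>b\<in>{x} \<times> F. (fst a, ad (snd a) (snd b)) = (x, z)"
    using assms unfolding fibre_vs_def by (force dest: conjunct1)
qed (use assms in \<open>auto simp: fibre_vs_def\<close>)

context diffeological_space
begin

lemma tplot_onI:
  assumes "D N V f" "connected V" "smooth_map n W N a" "smooth_map n W N v"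
    and "\<And>z. z \<in> W \<Longrightarrow> a z \<in> V" "\<And>z. z \<in> W \<Longrightarrow> p z = (f (a z), tang D N V f (a z) (v z))"
  shows "tplot_on D n W p"
  unfolding tplot_on_def
  by (intro exI[of _ N] exI[of _ V] exI[of _ f] exI[of _ a] exI[of _ v]) (use assms in auto)

lemma tplot_onE:
  assumes "tplot_on D n W p"
  obtains N V f a v where "D N V f" "connected V" "smooth_map n W N a" "smooth_map n W N v"
    "\<forall>z\<in>W. a z \<in> V" "\<forall>z\<in>W. v z \<in> Rn N"
    "\<forall>z\<in>W. p z = (f (a z), tang D N V f (a z) (v z))"
  using assms unfolding tplot_on_def smooth_map_def image_subset_iff by blast

lemma locally_tplotE:
  assumes "locally_tplot D n U p" "u \<in> U"
  obtains W where "open_Rn n W" "u \<in> W" "W \<subseteq> U" "tplot_on D n W p"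
  using assms unfolding locally_tplot_def by blast

lemma locally_tplotI:
  assumes "open_Rn n U"
    and "\<And>u. u \<in> U \<Longrightarrow> \<exists>W. open_Rn n W \<and> u \<in> W \<and> W \<subseteq> U \<and> tplot_on D n W p"
  shows "locally_tplot D n U p"
  using assms unfolding locally_tplot_def by simp

lemma tplot_on_restrict:
  assumes "tplot_on D n W p" "smooth_map m W' n h" "h ` W' \<subseteq> W"
  shows "tplot_on D m W' (\<lambda>z. p (h z))"
proof -
  obtain N V f a v where *: "D N V f" "connected V" "smooth_map n W N a" "smooth_map n W N v"
    "\<forall>z\<in>W. a z \<in> V" "\<forall>z\<in>W. v z \<in> Rn N"
    "\<forall>z\<in>W. p z = (f (a z), tang D N V f (a z) (v z))"
    using assms(1) by (rule tplot_onE)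
  have "smooth_map m W' N (a \<circ> h)" "smooth_map m W' N (v \<circ> h)"
    using smooth_map_compose[OF *(3) assms(2,3)] smooth_map_compose[OF *(4) assms(2,3)] .
  then show ?thesis
    by (rule tplot_onI[OF *(1,2)]) (use *(5,7) assms(3) in auto)
qed

lemma tplot_on_subset:
  assumes "tplot_on D n W p" "open_Rn n W'" "W' \<subseteq> W"
  shows "tplot_on D n W' p"
  using tplot_on_restrict[OF assms(1) smooth_map_id[OF assms(2)]] assms(3) by simp

lemma tplot_on_imp_locally: "open_Rn n U \<Longrightarrow> tplot_on D n U p \<Longrightarrow> locally_tplot D n U p"
  unfolding locally_tplot_def by blast

end

section \<open>Hector's diffeology on a diffeological group\<close>

locale diff_group =
  fixes G :: "('g, 'm) monoid_scheme" (structure) and D :: "'g diffeo"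
  assumes diff_group: "diffeological_group G D"

sublocale diff_group \<subseteq> group G
  using diff_group by (simp add: diffeological_group_def)

sublocale diff_group \<subseteq> diffeological_space "carrier G" D
  using diff_group by unfold_locales (simp add: diffeological_group_def)

context diff_group
begin

lemma D_mult: "D n U P \<Longrightarrow> D n U Q \<Longrightarrow> D n U (\<lambda>u. P u \<otimes> Q u)"
  and D_inv: "D n U P \<Longrightarrow> D n U (\<lambda>u. inv (P u))"
  using diff_group by (simp_all add: diffeological_group_def)

text \<open>The bracketed factor is \<open>g\<close> translated so as to pass through the identity
  when its last two blocks coincide; there it leaves \<open>f\<close> unchanged.\<close>

definition sumplot :: "nat \<Rightarrow> nat \<Rightarrow> (vec \<Rightarrow> 'g) \<Rightarrow> (vec \<Rightarrow> 'g) \<Rightarrow> vec \<Rightarrow> 'g" where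
  "sumplot n m f g = (\<lambda>w. f (fstpart n w) \<otimes>
     (inv (g (dropv m (dropv n w))) \<otimes> g (fstpart m (dropv n w))))"

lemma sumplot_pairv:
  "x \<in> Rn n \<Longrightarrow> y \<in> Rn m \<Longrightarrow> sumplot n m f g (pairv n x (pairv m y z)) = f x \<otimes> (inv (g z) \<otimes> g y)"
  by (simp add: sumplot_def fstpart_pairv)

lemma D_sumplot:
  assumes "D n U f" "D m V g"
  shows "D (n + (m + m)) (pset n U (pset m V V)) (sumplot n m f g)"
proof -
  have V: "open_Rn m V" "open_Rn (m + m) (pset m V V)" and U: "open_Rn n U"
    using assms D_open open_pset by auto
  have "D (m + m) (pset m V V) (\<lambda>w. inv (g (dropv m w)) \<otimes> g (fstpart m w))"
    by (intro D_mult D_inv D_dropv[OF assms(2) V(1)] D_fstpart[OF assms(2) V(1)])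
  from D_mult[OF D_fstpart[OF assms(1) V(2)] D_dropv[OF this U]]
  show ?thesis by (simp add: sumplot_def)
qed

lemma sum_tang:
  assumes f: "D n U f" "connected U" "u \<in> U" and g: "D m V g" "connected V" "b \<in> V"
    and eq: "f u = g b" and v: "v \<in> Rn n" and w: "w \<in> Rn m"
  defines "T \<equiv> tang D (n + (m + m)) (pset n U (pset m V V)) (sumplot n m f g)
      (pairv n u (pairv m b b)) (pairv n v (pairv m w zv))"
  shows "sumplot n m f g (pairv n u (pairv m b b)) = f u"
    and "tadd D (f u) (tang D n U f u v) (tang D m V g b w) = T"
proof -
  let ?N = "n + (m + m)" and ?\<Omega> = "pset n U (pset m V V)" and ?K = "sumplot n m f g"
    and ?p = "pairv n u (pairv m b b)"
  have sub: "U \<subseteq> Rn n" "V \<subseteq> Rn m" using f g D_open open_Rn_subset by blast+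
  have mem: "f x \<in> carrier G" "g y \<in> carrier G" if "x \<in> U" "y \<in> V" for x y
    using f g that D_mem by blast+
  have K: "D ?N ?\<Omega> ?K" "connected ?\<Omega>" "?p \<in> ?\<Omega>"
    using f g by (auto intro: D_sumplot connected_pset pairv_mem_pset)
  have ub: "u \<in> Rn n" "b \<in> Rn m" using f g sub by blast+
  show base: "?K ?p = f u"
    using ub mem[OF f(3) g(3)] by (simp add: sumplot_pairv)
  have 1: "tang D n U f u v = tang D ?N ?\<Omega> ?K ?p (inc 0 n v)"
  proof (rule tang_inc[OF f K base _ v])
    fix z assume z: "z \<in> Rn n" "vadd z u \<in> U"
    have "vadd (inc 0 n z) ?p = pairv n (vadd z u) (pairv m b b)"
      by (rule vadd_inc_fst[OF z(1)])
    then show "vadd (inc 0 n z) ?p \<in> ?\<Omega> \<and> ?K (vadd (inc 0 n z) ?p) = f (vadd z u)"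
      using z g(3) mem[OF z(2) g(3)] ub vadd_Rn by (simp add: sumplot_pairv pairv_mem_pset)
  qed simp
  \<comment> \<open>Only the middle block moves here, and \<open>f u\<close> cancels against
    \<open>inv (g b)\<close> because the base points agree.\<close>
  have 2: "tang D m V g b w = tang D ?N ?\<Omega> ?K ?p (inc n m w)"
  proof (rule tang_inc[OF g K _ _ w])
    show "?K ?p = g b" using base eq by simp
    fix z assume z: "z \<in> Rn m" "vadd z b \<in> V"
    have "vadd (inc n m z) ?p = pairv n u (pairv m (vadd z b) b)"
      by (intro ext) (auto simp: vadd_def inc_def pairv_def)
    moreover have "g b \<otimes> (inv g b \<otimes> g (vadd z b)) = g (vadd z b)"
      using mem[OF f(3) g(3)] mem[OF f(3) z(2)] by (simp add: m_assoc[symmetric])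
    ultimately show "vadd (inc n m z) ?p \<in> ?\<Omega> \<and> ?K (vadd (inc n m z) ?p) = g (vadd z b)"
      using z f(3) g(3) ub vadd_Rn by (simp add: sumplot_pairv pairv_mem_pset eq)
  qed simp
  have "vadd (inc 0 n v) (inc n m w) = pairv n v (pairv m w zv)"
    by (intro ext) (auto simp: vadd_def inc_def pairv_def zv_def)
  then show "tadd D (f u) (tang D n U f u v) (tang D m V g b w) = T"
    using tang_add[OF K inc_Rn inc_Rn, of 0 n n m v w] by (simp add: 1 2 base T_def)
qed

lemma TB_tang:
  assumes "D n U f" "connected U" "u \<in> U" "v \<in> Rn n"
  shows "(f u, tang D n U f u v) \<in> TB (carrier G) D"
  using assms D_mem tang_Tspace by (simp add: TB_def)

section \<open>Tangent vectors carried by a single plot\<close>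

definition single :: "'g \<Rightarrow> 'g tvec \<Rightarrow> bool" where
  "single x t \<longleftrightarrow> (\<exists>n U f u v. D n U f \<and> connected U \<and> u \<in> U \<and> v \<in> Rn n \<and> f u = x \<and> t = tang D n U f u v)"

lemma singleI: "D n U f \<Longrightarrow> connected U \<Longrightarrow> u \<in> U \<Longrightarrow> v \<in> Rn n \<Longrightarrow> single (f u) (tang D n U f u v)"
  unfolding single_def by blast

text \<open>A pointed plot is its own translate by the zero vector, so a summand of the colimit is a
  tangent vector of that plot at \<open>zv\<close>.\<close>

lemma single_delta:
  assumes "pplot D x P" "v \<in> Rn (fst P)"
  shows "single x (tcls D x (delta P v))"
proof -
  obtain n U p where P: "P = (n, U, p)" by (cases P)
  have p: "D n U p" "connected U" "zv \<in> U" "p zv = x" using assms(1) by (auto simp: P pplot_def)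
  have "vadd z zv = z" for z by (simp add: vadd_def zv_def)
  moreover have "U \<subseteq> Rn n" using p(1) D_open open_Rn_subset by blast
  ultimately have "splot n U p zv = P" by (auto simp: splot_def shift_def P)
  then have "tcls D x (delta P v) = tang D n U p zv v" by (simp add: tang_def p(4))
  then show ?thesis using singleI[OF p(1-3), of v] assms(2) by (simp add: P p(4))
qed

lemma single_tadd:
  assumes "single x s" "single x t"
  shows "single x (tadd D x s t)"
proof -
  obtain n U f u v where f: "D n U f" "connected U" "u \<in> U" "v \<in> Rn n" "f u = x" "s = tang D n U f u v"
    using assms(1) unfolding single_def by blast
  obtain m V g b w where g: "D m V g" "connected V" "b \<in> V" "w \<in> Rn m" "g b = x" "t = tang D m V g b w"
    using assms(2) unfolding single_def by blast
  have "f u = g b" using f g by simp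
  note st = sum_tang[OF f(1-3) g(1-3) this f(4) g(4)]
  let ?p = "pairv n u (pairv m b b)" and ?v = "pairv n v (pairv m w zv)"
  have "?p \<in> pset n U (pset m V V)" "?v \<in> Rn (n + (m + m))"
    using f g by (auto intro!: pairv_mem_pset pairv_Rn)
  from singleI[OF D_sumplot[OF f(1) g(1)] connected_pset[OF f(2) connected_pset[OF g(2) g(2)]] this]
  show ?thesis using st by (simp add: f(5,6) g(6))
qed

lemma single_tzero:
  assumes "x \<in> carrier G"
  shows "single x (tzero D x)"
proof -
  \<comment> \<open>The zero vector is carried by the constant plot on the point R^0, which is
    connected and has zero as its only velocity.\<close>
  have "Rn 0 = {zv}" by (auto simp: Rn_def zv_def)
  then have "connected (Rn 0)" by simp
  from singleI[OF D_const[OF open_Rn_whole assms] this zv_Rn zv_Rn]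
  show ?thesis by (simp add: tang_zero)
qed

text \<open>Induction over a finite superset of the support: one summand is split off, and
  \<open>single_tadd\<close> merges it with the rest into one plot. A superset is used so that an
  index with zero entry can simply be dropped.\<close>

lemma Tspace_single:
  assumes "x \<in> carrier G" "t \<in> Tspace D x"
  shows "single x t"
proof -
  have "single x (tcls D x c)" if "finite S" "is_fsum D x c" "{P. c P \<noteq> zv} \<subseteq> S" for S c
    using that
  proof (induction S arbitrary: c)
    case empty
    then have "c = fzero" by (auto simp: fzero_def)
    then show ?case using single_tzero[OF assms(1)] by (simp add: tzero_def)
  next
    case (insert P S)
    show ?case
    proof (cases "c P = zv")
      case True
      then show ?thesis using insert by (intro insert.IH) auto
    next
      case False
      let ?d = "c(P := zv)"
      have sub: "{Q. ?d Q \<noteq> zv} \<subseteq> {Q. c Q \<noteq> zv}" by auto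
      then have "finite {Q. ?d Q \<noteq> zv}"
        by (rule finite_subset) (use insert.prems in \<open>simp add: is_fsum_def\<close>)
      then have d: "is_fsum D x ?d" using insert.prems by (auto simp: is_fsum_def)
      have P: "pplot D x P" "c P \<in> Rn (fst P)" using insert.prems False by (simp_all add: is_fsum_def del: split_paired_All)
      have "c = fadd ?d (delta P (c P))"
        by (intro ext) (simp add: fsum_defs)
      then have "tcls D x c = tadd D x (tcls D x ?d) (tcls D x (delta P (c P)))"
        using tadd_tcls[OF d is_fsum_delta[OF P]] by simp
      moreover have "single x (tcls D x ?d)"
        using insert.prems by (intro insert.IH d) auto
      ultimately show ?thesis using single_tadd single_delta[OF P] by simp
    qed
  qed
  moreover obtain c where "is_fsum D x c" "t = tcls D x c" using assms(2) by (rule TspaceE)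
  ultimately show ?thesis by (auto simp: is_fsum_def)
qed

lemma tplot_on_const:
  assumes "y \<in> TB (carrier G) D" "open_Rn n W"
  shows "tplot_on D n W (\<lambda>_. y)"
proof -
  have "single (fst y) (snd y)" using assms(1) by (intro Tspace_single) (auto simp: TB_def)
  then obtain N U f u v where *: "D N U f" "connected U" "u \<in> U" "v \<in> Rn N"
      "f u = fst y" "snd y = tang D N U f u v"
    unfolding single_def by blast
  have "u \<in> Rn N" using * D_open open_Rn_subset by blast
  then show ?thesis
    by (intro tplot_onI[OF *(1,2), where a = "\<lambda>_. u" and v = "\<lambda>_. v"])
       (use *(3-6) assms(2) in \<open>simp_all add: smooth_map_const prod_eq_iff\<close>)
qed

lemma tplot_on_TB:
  assumes "tplot_on D n W p" "z \<in> W"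
  shows "p z \<in> TB (carrier G) D"
proof -
  obtain N V f a v where *: "D N V f" "connected V" "smooth_map n W N a" "smooth_map n W N v"
    "\<forall>z\<in>W. a z \<in> V" "\<forall>z\<in>W. v z \<in> Rn N"
    "\<forall>z\<in>W. p z = (f (a z), tang D N V f (a z) (v z))"
    using assms(1) by (rule tplot_onE)
  then show ?thesis using TB_tang[OF *(1,2)] assms(2) by simp
qed

text \<open>The group law enters only through the constant maps, by way of
  \<open>Tspace_single\<close>. The other clauses follow from restricting and composing the maps
  \<open>a\<close> and \<open>v\<close>.\<close>

lemma diffeology_locally_tplot: "diffeology (TB (carrier G) D) (locally_tplot D)"
proof (rule diffeologyI)
  fix n U p assume p: "locally_tplot D n U p"
  show "open_Rn n U" using p by (simp add: locally_tplot_def)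
  show "p u \<in> TB (carrier G) D" if "u \<in> U" for u
    using p that tplot_on_TB unfolding locally_tplot_def by blast
  show "locally_tplot D n U q" if eq: "\<And>u. u \<in> U \<Longrightarrow> p u = q u" for q
  proof -
    have "tplot_on D n W q" if "tplot_on D n W p" "W \<subseteq> U" for W
    proof -
      have "\<forall>z\<in>W. q z = p z" using eq that(2) by auto
      then show ?thesis using that(1) unfolding tplot_on_def by simp
    qed
    then show ?thesis using p unfolding locally_tplot_def by meson
  qed
  fix m V f assume f: "smooth_map m V n f" "f ` V \<subseteq> U"
  have V: "open_Rn m V" using f by (simp add: smooth_map_def)
  show "locally_tplot D m V (\<lambda>z. p (f z))"
    unfolding locally_tplot_def
  proof (intro conjI ballI V)
    fix z assume z: "z \<in> V"
    then obtain W where W: "open_Rn n W" "f z \<in> W" "tplot_on D n W p"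
      using p f unfolding locally_tplot_def by blast
    let ?W = "{x \<in> V. f x \<in> W}"
    have "open_Rn m ?W"
      using f by (intro open_Rn_vimage[OF W(1) V smooth_map_continuous[OF f(1)]]) (simp add: smooth_map_def)
    moreover from this have "tplot_on D m ?W (\<lambda>z. p (f z))"
      by (intro tplot_on_restrict[OF W(3)] smooth_map_restrict[OF f(1)]) auto
    ultimately show "\<exists>W. open_Rn m W \<and> z \<in> W \<and> W \<subseteq> V \<and> tplot_on D m W (\<lambda>z. p (f z))"
      using z W(2) by (intro exI[of _ ?W]) auto
  qed
next
  fix n U y assume "open_Rn n U" "y \<in> TB (carrier G) D"
  then show "locally_tplot D n U (\<lambda>_. y)"
    by (intro tplot_on_imp_locally tplot_on_const)
next
  fix n U p assume "open_Rn n U"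
    and "\<And>u. u \<in> U \<Longrightarrow> \<exists>W. open_Rn n W \<and> u \<in> W \<and> W \<subseteq> U \<and> locally_tplot D n W p"
  then show "locally_tplot D n U p"
    unfolding locally_tplot_def by (meson subset_trans)
qed

lemma open_TU:
  assumes "open_Rn n U"
  shows "open_Rn (2 * n) {w \<in> Rn (2 * n). fstpart n w \<in> U}"
  using assms
  by (intro open_Rn_vimage[OF _ open_Rn_whole smooth_map_continuous[OF smooth_map_fstpart[OF open_Rn_whole]]])
     (auto intro: fstpart_Rn)

text \<open>The generators are tangent maps and \<open>locally_tplot\<close> is a diffeology, which
  gives one inclusion. Conversely, any diffeology containing the generators contains their
  composites with smooth maps and, by the sheaf condition, whatever is locally such a
  composite.\<close>

lemma hector_eq: "hector (carrier G) D = locally_tplot D"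
proof (intro ext iffI)
  fix n U p
  { assume "hector (carrier G) D n U p"
    moreover have "locally_tplot D m W g" if gen: "(m, W, g) \<in> hector_gens D" for m W g
    proof -
      obtain k V f where *: "m = 2 * k" "W = {w \<in> Rn (2 * k). fstpart k w \<in> V}" "g = Tplot D k V f"
        "D k V f" "connected V"
        using gen by (auto simp: hector_gens_def)
      have W: "open_Rn m W" using * open_TU D_open by simp
      have "tplot_on D m W g"
        by (rule tplot_onI[OF *(4,5) smooth_map_fstpart[OF W] smooth_map_sndpart[OF W]])
           (auto simp: *(2,3) Tplot_eq)
      then show ?thesis by (rule tplot_on_imp_locally[OF W])
    qed
    ultimately show "locally_tplot D n U p"
      using diffeology_locally_tplot unfolding hector_def gen_diff_def by blast }
  assume p: "locally_tplot D n U p"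
  have U: "open_Rn n U" using p by (simp add: locally_tplot_def)
  show "hector (carrier G) D n U p"
    unfolding hector_def gen_diff_def
  proof (intro allI impI, elim conjE)
    fix E assume E: "diffeology (TB (carrier G) D) E" and gens: "\<forall>(m, W, g)\<in>hector_gens D. E m W g"
    have "E n W p" if W: "tplot_on D n W p" for W
    proof -
      obtain N V f a v where *: "D N V f" "connected V" "smooth_map n W N a" "smooth_map n W N v"
        "\<forall>z\<in>W. a z \<in> V" "\<forall>z\<in>W. v z \<in> Rn N"
        "\<forall>z\<in>W. p z = (f (a z), tang D N V f (a z) (v z))"
        using W by (rule tplot_onE)
      \<comment> \<open>Base point and velocity are joined into one smooth map into TV, so that
        \<open>p\<close> becomes a generator precomposed with it.\<close>
      let ?h = "\<lambda>z. pairv N (a z) (v z)" and ?TV = "{w \<in> Rn (2 * N). fstpart N w \<in> V}"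
      have "(2 * N, ?TV, Tplot D N V f) \<in> hector_gens D"
        unfolding hector_gens_def using *(1,2) by blast
      from gens[rule_format, OF this] have "E (2 * N) ?TV (Tplot D N V f)" by simp
      moreover have h: "smooth_map n W (2 * N) ?h"
        using smooth_map_pairv[OF *(3,4)] by (simp add: mult_2)
      moreover have a: "a z \<in> Rn N" if "z \<in> W" for z
        using *(3) that by (auto simp: smooth_map_def)
      then have "?h ` W \<subseteq> ?TV"
        using h *(5) by (auto simp: smooth_map_def fstpart_pairv)
      ultimately have "E n W (\<lambda>z. Tplot D N V f (?h z))" by (rule diffeology_compose[OF E])
      then show ?thesis
        by (rule diffeology_cong[OF E]) (simp add: Tplot_eq a fstpart_pairv sndpart_pairv *(6,7))
    qed
    then show "E n U p"
      using p unfolding locally_tplot_def by (intro diffeology_sheaf[OF E U]) blast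
  qed
qed

section \<open>Projection and fibrewise operations on Hector plots\<close>

lemma smooth_fst_locally_tplot:
  assumes "locally_tplot D n U p"
  shows "D n U (\<lambda>z. fst (p z))"
proof -
  have "D n W (\<lambda>z. fst (p z))" if W: "tplot_on D n W p" for W
  proof -
    obtain N V f a v where *: "D N V f" "connected V" "smooth_map n W N a" "smooth_map n W N v"
      "\<forall>z\<in>W. a z \<in> V" "\<forall>z\<in>W. v z \<in> Rn N" "\<forall>z\<in>W. p z = (f (a z), tang D N V f (a z) (v z))"
      using W by (rule tplot_onE)
    have "a ` W \<subseteq> V" using *(5) by auto
    from D_compose[OF *(1,3) this] show ?thesis by (rule D_cong) (simp add: *(7))
  qed
  then show ?thesis
    using assms unfolding locally_tplot_def by (intro diffeology_sheaf[OF diffeology]) (blast+)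
qed

lemma locally_tplot_tbadd:
  assumes P: "locally_tplot D n U P" and Q: "locally_tplot D n U Q"
    and eq: "\<And>u. u \<in> U \<Longrightarrow> fst (P u) = fst (Q u)"
  shows "locally_tplot D n U (\<lambda>u. tbadd D (P u) (Q u))"
  unfolding locally_tplot_def
proof (intro conjI ballI)
  show "open_Rn n U" using P by (simp add: locally_tplot_def)
  fix u assume u: "u \<in> U"
  obtain W1 where W1: "open_Rn n W1" "u \<in> W1" "W1 \<subseteq> U" "tplot_on D n W1 P"
    using P u unfolding locally_tplot_def by blast
  obtain W2 where W2: "open_Rn n W2" "u \<in> W2" "W2 \<subseteq> U" "tplot_on D n W2 Q"
    using Q u unfolding locally_tplot_def by blast
  define W where "W = W1 \<inter> W2"
  have W: "open_Rn n W" "u \<in> W" "W \<subseteq> U" using W1 W2 by (auto simp: W_def open_Rn_Int)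
  have PQ: "tplot_on D n W P" "tplot_on D n W Q"
    using tplot_on_subset[OF W1(4) W(1)] tplot_on_subset[OF W2(4) W(1)] by (auto simp: W_def)
  obtain N V f a v where f: "D N V f" "connected V" "smooth_map n W N a" "smooth_map n W N v"
    "\<forall>z\<in>W. a z \<in> V" "\<forall>z\<in>W. v z \<in> Rn N"
    "\<forall>z\<in>W. P z = (f (a z), tang D N V f (a z) (v z))"
    using PQ(1) by (rule tplot_onE)
  obtain M V' g b w where g: "D M V' g" "connected V'" "smooth_map n W M b" "smooth_map n W M w"
    "\<forall>z\<in>W. b z \<in> V'" "\<forall>z\<in>W. w z \<in> Rn M"
    "\<forall>z\<in>W. Q z = (g (b z), tang D M V' g (b z) (w z))"
    using PQ(2) by (rule tplot_onE)
  let ?\<Omega> = "pset N V (pset M V' V')" and ?K = "sumplot N M f g"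
  \<comment> \<open>Velocities are data independent of how the base point depends on
    \<open>z\<close>: the third block follows \<open>b z\<close> and still has velocity
    \<open>zv\<close>.\<close>
  let ?a = "\<lambda>z. pairv N (a z) (pairv M (b z) (b z))" and ?v = "\<lambda>z. pairv N (v z) (pairv M (w z) zv)"
  have "tbadd D (P z) (Q z) = (?K (?a z), tang D (N + (M + M)) ?\<Omega> ?K (?a z) (?v z))"
    if z: "z \<in> W" for z
  proof -
    have "f (a z) = g (b z)" using eq[of z] f(7)[rule_format, OF z] g(7)[rule_format, OF z] z W(3) by auto
    from sum_tang[OF f(1,2) f(5)[rule_format, OF z] g(1,2) g(5)[rule_format, OF z] this f(6)[rule_format, OF z] g(6)[rule_format, OF z]]
    show ?thesis by (simp add: tbadd_def f(7)[rule_format, OF z] g(7)[rule_format, OF z])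
  qed
  moreover have "smooth_map n W (N + (M + M)) ?a" "smooth_map n W (N + (M + M)) ?v"
    using f g W(1) by (auto intro!: smooth_map_pairv smooth_map_const)
  moreover have "?a z \<in> ?\<Omega>" if "z \<in> W" for z using f(5) g(5) that by (intro pairv_mem_pset) auto
  ultimately have "tplot_on D n W (\<lambda>u. tbadd D (P u) (Q u))"
    by (intro tplot_onI[OF D_sumplot[OF f(1) g(1)] connected_pset[OF f(2) connected_pset[OF g(2) g(2)]],
          where a = ?a and v = ?v])
  then show "\<exists>W. open_Rn n W \<and> u \<in> W \<and> W \<subseteq> U \<and> tplot_on D n W (\<lambda>u. tbadd D (P u) (Q u))"
    using W by blast
qed

text \<open>Scaling acts on the velocity alone, so the plot and the map of base points stay as they
  are.\<close>

lemma locally_tplot_tbscale: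
  assumes r: "smooth_fn n U r" and P: "locally_tplot D n U P"
  shows "locally_tplot D n U (\<lambda>u. tbscale D (r u) (P u))"
  unfolding locally_tplot_def
proof (intro conjI ballI)
  show "open_Rn n U" using P by (simp add: locally_tplot_def)
  fix u assume u: "u \<in> U"
  obtain W where W: "open_Rn n W" "u \<in> W" "W \<subseteq> U" "tplot_on D n W P"
    using P u unfolding locally_tplot_def by blast
  obtain N V f a v where f: "D N V f" "connected V" "smooth_map n W N a" "smooth_map n W N v"
    "\<forall>z\<in>W. a z \<in> V" "\<forall>z\<in>W. v z \<in> Rn N"
    "\<forall>z\<in>W. P z = (f (a z), tang D N V f (a z) (v z))"
    using W(4) by (rule tplot_onE)
  let ?v = "\<lambda>z i. r z * v z i"
  have "smooth_fn n W r"
    using smooth_fn_compose[OF r smooth_map_id[OF W(1)]] W(3) by simp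
  then have "smooth_map n W N ?v"
    using f(4) by (auto simp: smooth_map_def intro: smooth_fn_mult) (auto simp: Rn_def)
  moreover have "tbscale D (r z) (P z) = (f (a z), tang D N V f (a z) (?v z))" if z: "z \<in> W" for z
  proof -
    show ?thesis
      using tang_scale[OF f(1,2) f(5)[rule_format, OF z] f(6)[rule_format, OF z], of "r z"] by (simp add: f(7)[rule_format, OF z] tbscale_def)
  qed
  ultimately have "tplot_on D n W (\<lambda>u. tbscale D (r u) (P u))"
    by (intro tplot_onI[OF f(1-3) _ f(5)[rule_format], where v = ?v])
  then show "\<exists>W. open_Rn n W \<and> u \<in> W \<and> W \<subseteq> U \<and> tplot_on D n W (\<lambda>u. tbscale D (r u) (P u))"
    using W by blast
qed

text \<open>On a connected piece of its domain \<open>p\<close> serves as its own base plot, with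
  the identity as map of base points and zero velocity.\<close>

lemma locally_tplot_tbzero:
  assumes "D n U p"
  shows "locally_tplot D n U (\<lambda>u. tbzero D (p u))"
  unfolding locally_tplot_def
proof (intro conjI ballI)
  show U: "open_Rn n U" by (rule D_open[OF assms])
  fix u assume "u \<in> U"
  then obtain W where W: "open_Rn n W" "connected W" "u \<in> W" "W \<subseteq> U"
    using connected_nbhd[OF U] by blast
  have "tplot_on D n W (\<lambda>u. tbzero D (p u))"
    by (rule tplot_onI[OF D_restrict[OF assms W(1,4)] W(2) smooth_map_id[OF W(1)]
          smooth_map_const[OF W(1) zv_Rn]])
       (simp_all add: tbzero_def tang_zero)
  then show "\<exists>W. open_Rn n W \<and> u \<in> W \<and> W \<subseteq> U \<and> tplot_on D n W (\<lambda>u. tbzero D (p u))"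
    using W by blast
qed

lemma dvs_hector:
  "dvs (TB (carrier G) D) (hector (carrier G) D) (carrier G) D fst (tbadd D) (tbscale D) (tbzero D)"
proof -
  have "fibre_vs {v \<in> TB (carrier G) D. fst v = x} (tbadd D) (tbscale D) (tbzero D x)"
    if "x \<in> carrier G" for x
    using fibre_vs_Tfib[OF that] by (simp add: Tfib_def)
  moreover have "\<forall>v\<in>TB (carrier G) D. fst v \<in> carrier G" by (auto simp: TB_def)
  ultimately show ?thesis
    unfolding dvs_def hector_eq smooth_def comp_def
    using diffeology_locally_tplot diffeology smooth_fst_locally_tplot locally_tplot_tbadd
      locally_tplot_tbscale locally_tplot_tbzero
    by (simp add: tbzero_def)
qed

text \<open>\<open>dvs_diff\<close> is the intersection of all admissible diffeologies above
  Hector's, and by \<open>dvs_hector\<close> Hector's is itself one of them.\<close>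

lemma dvs_diff_eq_hector: "dvs_diff (carrier G) D = hector (carrier G) D"
proof (intro ext iffI)
  fix n U p
  show "hector (carrier G) D n U p" if "dvs_diff (carrier G) D n U p"
    using that[unfolded dvs_diff_def, rule_format, of "hector (carrier G) D"] dvs_hector by simp
qed (simp add: dvs_diff_def)

subsection \<open>Left translation of tangent vectors\<close>

text \<open>Indices are functions on all of \<open>vec\<close>. Leaving the values outside \<open>U\<close> and outside the carrier
  untouched makes the action invertible on every index, so \<open>push\<close> is plain reindexing.\<close>

definition lact :: "'g \<Rightarrow> 'g pidx \<Rightarrow> 'g pidx" where
  "lact g P = (case P of (n, U, p) \<Rightarrow> (n, U, \<lambda>u. if u \<in> U \<and> p u \<in> carrier G then g \<otimes> p u else p u))"

definition push :: "'g \<Rightarrow> 'g fsum \<Rightarrow> 'g fsum" where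
  "push g c = (\<lambda>P. c (lact (inv g) P))"

text \<open>Acting on every member of a class avoids choosing representatives;
  \<open>ltrans_tcls\<close> shows that the image is again a full class.\<close>

definition ltrans :: "'g \<Rightarrow> 'g tvec \<Rightarrow> 'g tvec" where
  "ltrans g t = push g ` t"

text \<open>Translation keeps carrier values in the carrier and leaves all others alone, so both
  applications take the same branch of the conditional.\<close>

lemma lact_lact_inv:
  assumes "g \<in> carrier G"
  shows "lact g (lact (inv g) P) = P" "lact (inv g) (lact g P) = P"
proof -
  obtain n U p where P: "P = (n, U, p)" by (cases P)
  show "lact g (lact (inv g) P) = P" "lact (inv g) (lact g P) = P"
    using assms by (auto simp: lact_def P fun_eq_iff m_assoc[symmetric])
qed

lemma fst_lact [simp]: "fst (lact g P) = fst P"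
  by (simp add: lact_def split: prod.split)

lemma push_push_inv:
  assumes "g \<in> carrier G"
  shows "push g (push (inv g) c) = c" "push (inv g) (push g c) = c"
  using assms by (simp_all add: push_def lact_lact_inv)

lemma push_linear:
  "push g (fadd c d) = fadd (push g c) (push g d)" "push g (fscale r c) = fscale r (push g c)"
  "push g (fsub c d) = fsub (push g c) (push g d)" "push g fzero = fzero"
  by (simp_all add: push_def fadd_def fscale_def fsub_def fzero_def)

lemma push_delta:
  assumes "g \<in> carrier G"
  shows "push g (delta P v) = delta (lact g P) v"
proof
  fix Q
  have "lact (inv g) Q = P \<longleftrightarrow> Q = lact g P" using lact_lact_inv[OF assms] by metis
  then show "push g (delta P v) Q = delta (lact g P) v Q" by (simp add: push_def delta_def)
qed

lemma D_lmult: "g \<in> carrier G \<Longrightarrow> D n U p \<Longrightarrow> D n U (\<lambda>u. g \<otimes> p u)"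
  by (rule D_mult[OF D_const[OF D_open]])

lemma pplot_lact:
  assumes "g \<in> carrier G" "pplot D x P"
  shows "pplot D (g \<otimes> x) (lact g P)"
proof -
  obtain n U p where P: "P = (n, U, p)" by (cases P)
  have p: "D n U p" "connected U" "zv \<in> U" "p zv = x" using assms by (auto simp: pplot_def P)
  have mem: "p u \<in> carrier G" if "u \<in> U" for u using D_mem[OF p(1) that] .
  have "D n U (\<lambda>u. if u \<in> U \<and> p u \<in> carrier G then g \<otimes> p u else p u)"
    using D_lmult[OF assms(1) p(1)] by (rule D_cong) (simp add: mem)
  then show ?thesis using p mem[OF p(3)] by (simp add: lact_def P pplot_def)
qed

lemma is_fsum_push:
  assumes "g \<in> carrier G" "is_fsum D x c"
  shows "is_fsum D (g \<otimes> x) (push g c)"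
proof -
  have "{P. push g c P \<noteq> zv} \<subseteq> lact g ` {P. c P \<noteq> zv}"
  proof
    fix P assume "P \<in> {P. push g c P \<noteq> zv}"
    then show "P \<in> lact g ` {P. c P \<noteq> zv}"
      using lact_lact_inv(1)[OF assms(1), of P]
      by (intro image_eqI[of _ _ "lact (inv g) P"]) (simp_all add: push_def)
  qed
  then have "finite {P. push g c P \<noteq> zv}"
    by (rule finite_subset) (use assms(2) in \<open>simp add: is_fsum_def\<close>)
  moreover have "pplot D (g \<otimes> x) P" if "push g c P \<noteq> zv" for P
  proof -
    have "pplot D x (lact (inv g) P)"
      using assms(2) that by (simp add: is_fsum_def push_def del: split_paired_All)
    from pplot_lact[OF assms(1) this] show ?thesis by (simp add: lact_lact_inv(1)[OF assms(1)])
  qed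
  moreover have "push g c P \<in> Rn (fst P)" for P
  proof -
    have "c (lact (inv g) P) \<in> Rn (fst (lact (inv g) P))"
      using assms(2) unfolding is_fsum_def by blast
    then show ?thesis by (simp add: push_def)
  qed
  ultimately show ?thesis unfolding is_fsum_def by blast
qed

text \<open>A morphism is a map between domains, which left translation does not alter. Hence the
  same \<open>f\<close>, with the same Jacobian, relates the translated plots.\<close>

lemma rel_push:
  assumes "g \<in> carrier G" "c \<in> rel D x"
  shows "push g c \<in> rel D (g \<otimes> x)"
  using assms(2)
proof induction
  case (rel_gen n U p m V q f v)
  \<comment> \<open>Plots take values in the carrier, so on the domain the conditional in
    \<open>lact\<close> always multiplies.\<close>
  obtain p' where p': "lact g (n, U, p) = (n, U, p')" "\<And>u. u \<in> U \<Longrightarrow> p' u = g \<otimes> p u"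
    using rel_gen(1) D_mem by (auto simp: lact_def pplot_def)
  obtain q' where q': "lact g (m, V, q) = (m, V, q')" "\<And>u. u \<in> V \<Longrightarrow> q' u = g \<otimes> q u"
    using rel_gen(2) D_mem by (auto simp: lact_def pplot_def)
  have "pmor (n, U, p') (m, V, q') f"
    using rel_gen(3) by (auto simp: pmor_def p'(2) q'(2) image_subset_iff)
  moreover have "pplot D (g \<otimes> x) (n, U, p')" "pplot D (g \<otimes> x) (m, V, q')"
    using pplot_lact[OF assms(1) rel_gen(1)] pplot_lact[OF assms(1) rel_gen(2)] by (simp_all add: p' q')
  ultimately show ?case
    using rel_gen(4) by (simp add: push_linear push_delta[OF assms(1)] p' q' rel.rel_gen)
qed (simp_all add: push_linear rel.rel_zero rel.rel_add rel.rel_scale)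

text \<open>\<open>push g\<close> respects both formal sums and relations. For the converse
  inclusion an element of the target class is pushed back by \<open>inv g\<close>, which respects
  them too.\<close>

lemma ltrans_tcls:
  assumes g: "g \<in> carrier G" and x: "x \<in> carrier G"
  shows "ltrans g (tcls D x c) = tcls D (g \<otimes> x) (push g c)"
proof (intro equalityI subsetI)
  fix d assume "d \<in> ltrans g (tcls D x c)"
  then obtain c' where c': "is_fsum D x c'" "fsub c c' \<in> rel D x" "d = push g c'"
    by (auto simp: ltrans_def tcls_def)
  show "d \<in> tcls D (g \<otimes> x) (push g c)"
    using is_fsum_push[OF g c'(1)] rel_push[OF g c'(2)] by (simp add: tcls_def c'(3) push_linear)
next
  fix d assume "d \<in> tcls D (g \<otimes> x) (push g c)"
  then have d: "is_fsum D (g \<otimes> x) d" "fsub (push g c) d \<in> rel D (g \<otimes> x)" by (simp_all add: tcls_def)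
  have gi: "inv g \<in> carrier G" and eq: "inv g \<otimes> (g \<otimes> x) = x" using g x by (simp_all add: m_assoc[symmetric])
  have "push (inv g) d \<in> tcls D x c"
    using is_fsum_push[OF gi d(1)] rel_push[OF gi d(2)]
    by (simp add: tcls_def eq push_linear push_push_inv[OF g])
  then show "d \<in> ltrans g (tcls D x c)"
    unfolding ltrans_def by (rule image_eqI[rotated]) (simp add: push_push_inv[OF g])
qed

lemma ltrans_ltrans_inv:
  assumes "g \<in> carrier G"
  shows "ltrans g (ltrans (inv g) t) = t" "ltrans (inv g) (ltrans g t) = t"
  by (simp_all add: ltrans_def image_image push_push_inv[OF assms])

lemma ltrans_Tspace:
  assumes "g \<in> carrier G" "x \<in> carrier G" "t \<in> Tspace D x"
  shows "ltrans g t \<in> Tspace D (g \<otimes> x)"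
  using assms(3) by (rule TspaceE) (simp add: ltrans_tcls assms(1,2) TspaceI is_fsum_push)

lemma ltrans_tadd:
  assumes "g \<in> carrier G" "x \<in> carrier G" "s \<in> Tspace D x" "t \<in> Tspace D x"
  shows "ltrans g (tadd D x s t) = tadd D (g \<otimes> x) (ltrans g s) (ltrans g t)"
  using assms(3,4)
  by (elim TspaceE) (simp add: ltrans_tcls tadd_tcls push_linear is_fsum_push assms(1,2))

lemma ltrans_tscale:
  assumes "g \<in> carrier G" "x \<in> carrier G" "t \<in> Tspace D x"
  shows "ltrans g (tscale D x r t) = tscale D (g \<otimes> x) r (ltrans g t)"
  using assms(3)
  by (elim TspaceE) (simp add: ltrans_tcls tscale_tcls push_linear is_fsum_push assms(1,2))

section \<open>Trivialisation of the bundle by left translation\<close>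

lemma D_product:
  assumes "D l W h" "D n V f"
  shows "D (l + n) (pset l W V) (\<lambda>w. h (fstpart l w) \<otimes> f (dropv l w))"
  by (rule D_mult[OF D_fstpart[OF assms(1) D_open[OF assms(2)]] D_dropv[OF assms(2) D_open[OF assms(1)]]])

text \<open>Freezing the first block at \<open>y\<close> turns the product plot into the translate
  of \<open>f\<close> by \<open>h y\<close>, so the first block of the velocity is zero. The
  translating element is a value of a plot so that \<open>y\<close> can vary later.\<close>

lemma ltrans_tang:
  assumes h: "D l W h" "connected W" "y \<in> W" and f: "D n V f" "connected V" "u \<in> V" and v: "v \<in> Rn n"
  shows "ltrans (h y) (tang D n V f u v) =
    tang D (l + n) (pset l W V) (\<lambda>w. h (fstpart l w) \<otimes> f (dropv l w)) (pairv l y u) (pairv l zv v)"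
proof -
  have y: "y \<in> Rn l" using h D_open open_Rn_subset by blast
  have hy: "h y \<in> carrier G" and fu: "f u \<in> carrier G" using h f D_mem by blast+
  obtain p where p: "lact (h y) (splot n V f u) = (n, shift n V u, p)"
    "\<And>z. z \<in> shift n V u \<Longrightarrow> p z = h y \<otimes> f (vadd z u)"
    using D_mem[OF f(1)] by (auto simp: lact_def splot_def shift_def)
  have "ltrans (h y) (tang D n V f u v) = tcls D (h y \<otimes> f u) (delta (n, shift n V u, p) v)"
    unfolding tang_def by (simp add: ltrans_tcls hy fu push_delta p(1))
  also have "\<dots> = tang D (l + n) (pset l W V) (\<lambda>w. h (fstpart l w) \<otimes> f (dropv l w)) (pairv l y u) (inc l n v)"
  proof (rule tcls_delta_tang[OF _ D_product[OF h(1) f(1)] connected_pset[OF h(2) f(2)] _ _ _ v])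
    show "pplot D (h y \<otimes> f u) (n, shift n V u, p)"
      using pplot_lact[OF hy pplot_splot[OF f]] by (simp add: p(1))
    fix z assume z: "z \<in> shift n V u"
    then have "vadd (inc l n z) (pairv l y u) = pairv l y (vadd z u)" "vadd z u \<in> V"
      using vadd_inc_snd by (auto simp: shift_def)
    then show "vadd (inc l n z) (pairv l y u) \<in> pset l W V \<and>
        h (fstpart l (vadd (inc l n z) (pairv l y u))) \<otimes> f (dropv l (vadd (inc l n z) (pairv l y u))) = p z"
      using h(3) y z by (simp add: pairv_mem_pset fstpart_pairv p(2))
  qed (use h(3) f(3) y in \<open>simp_all add: pairv_mem_pset fstpart_pairv\<close>)
  also have "inc l n v = pairv l zv v" by (rule inc_snd[OF v])
  finally show ?thesis .
qed

text \<open>The translating element \<open>inv (f (a z))\<close> depends on the same parameter as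
  the point it moves, so the base point runs along the diagonal of \<open>V\<close> times
  \<open>V\<close>, where the product plot has the value \<open>\<one>\<close>.\<close>

lemma locally_tplot_to_identity:
  assumes P: "locally_tplot D n U P"
  shows "locally_tplot D n U (\<lambda>z. (\<one>, ltrans (inv (fst (P z))) (snd (P z))))"
proof (rule locally_tplotI)
  show "open_Rn n U" using P by (simp add: locally_tplot_def)
  fix u assume u: "u \<in> U"
  obtain W where W: "open_Rn n W" "u \<in> W" "W \<subseteq> U" "tplot_on D n W P"
    using P u by (rule locally_tplotE)
  obtain N V f a v where f: "D N V f" "connected V" "smooth_map n W N a" "smooth_map n W N v"
    "\<forall>z\<in>W. a z \<in> V" "\<forall>z\<in>W. v z \<in> Rn N" "\<forall>z\<in>W. P z = (f (a z), tang D N V f (a z) (v z))"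
    using W(4) by (rule tplot_onE)
  let ?h = "\<lambda>w. inv (f w)"
  let ?K = "\<lambda>w. ?h (fstpart N w) \<otimes> f (dropv N w)"
  have h: "D N V ?h" by (rule D_inv[OF f(1)])
  have "tplot_on D n W (\<lambda>z. (\<one>, ltrans (inv (fst (P z))) (snd (P z))))"
  proof (rule tplot_onI[OF D_product[OF h f(1)] connected_pset[OF f(2) f(2)]])
    show "smooth_map n W (N + N) (\<lambda>z. pairv N (a z) (a z))" "smooth_map n W (N + N) (\<lambda>z. pairv N zv (v z))"
      by (intro smooth_map_pairv f(3,4) smooth_map_const W(1) zv_Rn)+
    fix z assume z: "z \<in> W"
    have az: "a z \<in> V" "a z \<in> Rn N" using f(3,5) z by (auto simp: smooth_map_def)
    show "pairv N (a z) (a z) \<in> pset N V V" using az by (simp add: pairv_mem_pset)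
    have "?K (pairv N (a z) (a z)) = \<one>"
      using az D_mem[OF f(1) az(1)] by (simp add: fstpart_pairv)
    then show "(\<one>, ltrans (inv (fst (P z))) (snd (P z))) =
        (?K (pairv N (a z) (a z)), tang D (N + N) (pset N V V) ?K (pairv N (a z) (a z)) (pairv N zv (v z)))"
      using ltrans_tang[OF h f(2) az(1) f(1,2) az(1) f(6)[rule_format, OF z]] f(7) z by simp
  qed
  then show "\<exists>W. open_Rn n W \<and> u \<in> W \<and> W \<subseteq> U \<and>
      tplot_on D n W (\<lambda>z. (\<one>, ltrans (inv (fst (P z))) (snd (P z))))"
    using W by blast
qed

text \<open>The translating element \<open>\<gamma> z\<close> is a plot of \<open>z\<close> itself,
  so \<open>z\<close> serves as the first block of the base point. Since \<open>P\<close> lies over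
  \<open>\<one>\<close>, the product plot has the value \<open>\<gamma> z\<close> there.\<close>

lemma locally_tplot_from_identity:
  assumes \<gamma>: "D n U \<gamma>" and P: "locally_tplot D n U P" and one: "\<And>z. z \<in> U \<Longrightarrow> fst (P z) = \<one>"
  shows "locally_tplot D n U (\<lambda>z. (\<gamma> z, ltrans (\<gamma> z) (snd (P z))))"
proof (rule locally_tplotI)
  show "open_Rn n U" using P by (simp add: locally_tplot_def)
  fix u assume u: "u \<in> U"
  obtain W' where W': "open_Rn n W'" "u \<in> W'" "W' \<subseteq> U" "tplot_on D n W' P"
    using P u by (rule locally_tplotE)
  \<comment> \<open>\<open>ltrans_tang\<close> asks for a connected domain of
    \<open>\<gamma>\<close>, and \<open>W'\<close> may fail to be connected.\<close>
  obtain W where W: "open_Rn n W" "connected W" "u \<in> W" "W \<subseteq> W'"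
    using connected_nbhd[OF W'(1,2)] by blast
  obtain N V f a v where f: "D N V f" "connected V" "smooth_map n W N a" "smooth_map n W N v"
    "\<forall>z\<in>W. a z \<in> V" "\<forall>z\<in>W. v z \<in> Rn N" "\<forall>z\<in>W. P z = (f (a z), tang D N V f (a z) (v z))"
    using tplot_on_subset[OF W'(4) W(1,4)] by (rule tplot_onE)
  have WU: "W \<subseteq> U" using W(4) W'(3) by blast
  have h: "D n W \<gamma>" by (rule D_restrict[OF \<gamma> W(1) WU])
  let ?K = "\<lambda>w. \<gamma> (fstpart n w) \<otimes> f (dropv n w)"
  have "tplot_on D n W (\<lambda>z. (\<gamma> z, ltrans (\<gamma> z) (snd (P z))))"
  proof (rule tplot_onI[OF D_product[OF h f(1)] connected_pset[OF W(2) f(2)]])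
    show "smooth_map n W (n + N) (\<lambda>z. pairv n z (a z))" "smooth_map n W (n + N) (\<lambda>z. pairv n zv (v z))"
      by (intro smooth_map_pairv f(3,4) smooth_map_const smooth_map_id W(1) zv_Rn)+
    fix z assume z: "z \<in> W"
    have az: "a z \<in> V" using f(5) z by simp
    have zn: "z \<in> Rn n" using z open_Rn_subset[OF W(1)] by blast
    show "pairv n z (a z) \<in> pset n W V" using az z by (simp add: pairv_mem_pset)
    have "f (a z) = \<one>" using one[of z] f(7) z WU by auto
    then have "?K (pairv n z (a z)) = \<gamma> z"
      using zn D_mem[OF h z] by (simp add: fstpart_pairv)
    then show "(\<gamma> z, ltrans (\<gamma> z) (snd (P z))) =
        (?K (pairv n z (a z)), tang D (n + N) (pset n W V) ?K (pairv n z (a z)) (pairv n zv (v z)))"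
      using ltrans_tang[OF h W(2) z f(1,2) az f(6)[rule_format, OF z]] f(7) z by simp
  qed
  then show "\<exists>W. open_Rn n W \<and> u \<in> W \<and> W \<subseteq> U \<and> tplot_on D n W (\<lambda>z. (\<gamma> z, ltrans (\<gamma> z) (snd (P z))))"
    using W WU by blast
qed

text \<open>The fibre over \<open>x\<close> is closed under the operations of the bundle, so their
  smoothness is inherited from \<open>TB\<close> in the second component.\<close>

lemma dvs_triv:
  assumes x: "x \<in> carrier G"
  shows "dvs (carrier G \<times> Tfib (carrier G) D x)
    (prod_diff D (sub_diff (hector (carrier G) D) (Tfib (carrier G) D x)))
    (carrier G) D fst (triv_add D) (triv_scale D) (triv_zero D x)"
proof -
  let ?F = "Tfib (carrier G) D x"
  let ?P = "prod_diff D (sub_diff (locally_tplot D) ?F)"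
  have sub: "?F \<subseteq> TB (carrier G) D" by (auto simp: Tfib_def)
  have dP: "diffeology (carrier G \<times> ?F) ?P"
    by (intro diffeology_prod_diff diffeology diffeology_sub_diff[OF diffeology_locally_tplot sub])
  have fib: "fibre_vs ?F (tbadd D) (tbscale D) (tbzero D x)" by (rule fibre_vs_Tfib[OF x])
  have zero: "tbzero D x \<in> ?F" by (simp add: Tfib_eq[OF x] tbzero_def Tspace_tzero)
  have add: "tbadd D a b \<in> ?F" if "a \<in> ?F" "b \<in> ?F" for a b
    using that by (auto simp: Tfib_eq[OF x] tbadd_def Tspace_tadd)
  have scale: "tbscale D r a \<in> ?F" if "a \<in> ?F" for r a
    using that by (auto simp: Tfib_eq[OF x] tbscale_def Tspace_tscale)
  have "fibre_vs {v \<in> carrier G \<times> ?F. fst v = g} (triv_add D) (triv_scale D) (triv_zero D x g)"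
    if "g \<in> carrier G" for g
  proof -
    have "{v \<in> carrier G \<times> ?F. fst v = g} = {g} \<times> ?F" using that by auto
    then show ?thesis
      using fibre_vs_triv[OF fib, of g]
      by (simp add: triv_add_def[abs_def] triv_scale_def[abs_def] triv_zero_def)
  qed
  moreover have "?P n U (\<lambda>u. triv_add D (A u) (B u))" if A: "?P n U A" and B: "?P n U B" for n U A B
  proof -
    have mem: "snd (A u) \<in> ?F" "snd (B u) \<in> ?F" if "u \<in> U" for u
      using A B that by (auto simp: prod_diff_def sub_diff_def)
    \<comment> \<open>Both second components lie over the constant point \<open>x\<close>, which is
      the equal-base condition for adding Hector plots.\<close>
    have "locally_tplot D n U (\<lambda>u. tbadd D (snd (A u)) (snd (B u)))"
    proof (rule locally_tplot_tbadd)
      show "fst (snd (A u)) = fst (snd (B u))" if "u \<in> U" for u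
        using mem[OF that] by (auto simp: Tfib_def)
    qed (use A B in \<open>simp_all add: prod_diff_def sub_diff_def comp_def\<close>)
    then show ?thesis
      using A add[OF mem] by (simp add: prod_diff_def sub_diff_def comp_def triv_add_def image_subset_iff)
  qed
  moreover have "?P n U (\<lambda>u. triv_scale D (r u) (A u))" if r: "smooth_fn n U r" and A: "?P n U A" for n U r A
  proof -
    have mem: "snd (A u) \<in> ?F" if "u \<in> U" for u
      using A that by (auto simp: prod_diff_def sub_diff_def)
    have "locally_tplot D n U (\<lambda>u. tbscale D (r u) (snd (A u)))"
      by (rule locally_tplot_tbscale[OF r]) (use A in \<open>simp add: prod_diff_def sub_diff_def comp_def\<close>)
    then show ?thesis
      using A scale[OF mem] by (simp add: prod_diff_def sub_diff_def comp_def triv_scale_def image_subset_iff)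
  qed
  moreover have "?P n U (\<lambda>u. triv_zero D x (p u))" if p: "D n U p" for n U p
  proof -
    have "locally_tplot D n U (\<lambda>u. tbzero D x)"
      using zero sub by (intro diffeology_const[OF diffeology_locally_tplot D_open[OF p]]) auto
    then show ?thesis
      using p zero by (simp add: prod_diff_def sub_diff_def comp_def triv_zero_def image_subset_iff)
  qed
  moreover have "D n U (\<lambda>u. fst (A u))" if "?P n U A" for n U A
    using that by (simp add: prod_diff_def comp_def)
  ultimately show ?thesis
    unfolding dvs_def hector_eq smooth_def comp_def
    using dP diffeology by (simp add: triv_zero_def)
qed

lemma dvs_iso_triv:
  "dvs_iso (TB (carrier G) D) (hector (carrier G) D) fst (tbadd D) (tbscale D)
    (carrier G \<times> Tfib (carrier G) D \<one>)
    (prod_diff D (sub_diff (hector (carrier G) D) (Tfib (carrier G) D \<one>))) fst (triv_add D) (triv_scale D)"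
proof -
  let ?TB = "TB (carrier G) D" and ?F = "Tfib (carrier G) D \<one>"
  let ?P = "prod_diff D (sub_diff (locally_tplot D) ?F)"
  \<comment> \<open>The second component is a pair with first entry \<open>\<one>\<close> because
    \<open>Tfib\<close> is a subset of the bundle and not the bare \<open>Tspace\<close>.\<close>
  define \<phi> where "\<phi> y = (fst y, (\<one>, ltrans (inv (fst y)) (snd y)))" for y :: "'g \<times> 'g tvec"
  define \<psi> where "\<psi> w = (fst w, ltrans (fst w) (snd (snd w)))" for w :: "'g \<times> ('g \<times> 'g tvec)"
  have F: "?F = {\<one>} \<times> Tspace D \<one>" by (rule Tfib_eq) simp
  have lt: "ltrans (inv x) t \<in> Tspace D \<one>" if "(x, t) \<in> ?TB" for x t
    using that ltrans_Tspace[of "inv x" x t] by (auto simp: TB_def)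
  have 1: "\<phi> y \<in> carrier G \<times> ?F \<and> \<psi> (\<phi> y) = y \<and> fst (\<phi> y) = fst y" if "y \<in> ?TB" for y
    using that lt by (cases y) (auto simp: \<phi>_def \<psi>_def F TB_def ltrans_ltrans_inv)
  have 2: "\<psi> w \<in> ?TB \<and> \<phi> (\<psi> w) = w" if mem: "w \<in> carrier G \<times> ?F" for w
  proof -
    obtain g t where w: "w = (g, (\<one>, t))" "g \<in> carrier G" "t \<in> Tspace D \<one>"
      using mem by (auto simp: F)
    then show ?thesis
      using ltrans_Tspace[of g \<one> t] by (simp add: \<phi>_def \<psi>_def TB_def ltrans_ltrans_inv)
  qed
  have 3: "?P n U (\<lambda>z. \<phi> (p z))" if p: "locally_tplot D n U p" for n U p
  proof -
    have "p z \<in> ?TB" if "z \<in> U" for z using diffeology_mem[OF diffeology_locally_tplot p that] .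
    then have "(\<lambda>z. (\<one>, ltrans (inv (fst (p z))) (snd (p z)))) ` U \<subseteq> ?F"
      using lt by (auto simp: F)
    then show ?thesis
      using smooth_fst_locally_tplot[OF p] locally_tplot_to_identity[OF p]
      by (simp add: prod_diff_def sub_diff_def comp_def \<phi>_def)
  qed
  have 4: "locally_tplot D n U (\<lambda>z. \<psi> (w z))" if w: "?P n U w" for n U w
  proof -
    have "fst (snd (w z)) = \<one>" if "z \<in> U" for z
      using w that by (auto simp: prod_diff_def sub_diff_def F image_subset_iff)
    then show ?thesis
      unfolding \<psi>_def using w
      by (intro locally_tplot_from_identity) (simp_all add: prod_diff_def sub_diff_def comp_def)
  qed
  have 5: "\<phi> (tbadd D a b) = triv_add D (\<phi> a) (\<phi> b)" if "a \<in> ?TB" "b \<in> ?TB" "fst a = fst b" for a b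
    using that ltrans_tadd[of "inv (fst a)" "fst a" "snd a" "snd b"]
    by (auto simp: \<phi>_def tbadd_def triv_add_def TB_def)
  have 6: "\<phi> (tbscale D r a) = triv_scale D r (\<phi> a)" if "a \<in> ?TB" for r a
    using that ltrans_tscale[of "inv (fst a)" "fst a" "snd a" r]
    by (auto simp: \<phi>_def tbscale_def triv_scale_def TB_def)
  show ?thesis
    unfolding dvs_iso_def hector_eq smooth_def comp_def
    by (intro exI[of _ \<phi>] exI[of _ \<psi>] conjI ballI allI impI) (simp_all add: 1 2 3 4 5 6)
qed

end

lemma dvs_iso_refl:
  "dvs V DV X DX pr ad sm z \<Longrightarrow> dvs_iso V DV pr ad sm V DV pr ad sm"
  unfolding dvs_iso_def by (intro exI[of _ id]) (simp add: smooth_def)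

theorem theorem4p15:
  fixes G :: "('g, 'm) monoid_scheme" and D :: "'g diffeo"
  assumes "diffeological_group G D"
  defines "X \<equiv> carrier G" and "e \<equiv> \<one>\<^bsub>G\<^esub>"
  defines "TH \<equiv> hector X D" and "TD \<equiv> dvs_diff X D"
  defines "Te \<equiv> Tfib X D e"
  shows "dvs (TB X D) TH X D fst (tbadd D) (tbscale D) (tbzero D)
    \<and> dvs (TB X D) TD X D fst (tbadd D) (tbscale D) (tbzero D)
    \<and> dvs (X \<times> Te) (prod_diff D (sub_diff TH Te)) X D fst (triv_add D) (triv_scale D) (triv_zero D e)
    \<and> dvs (X \<times> Te) (prod_diff D (sub_diff TD Te)) X D fst (triv_add D) (triv_scale D) (triv_zero D e)
    \<and> dvs_iso (TB X D) TH fst (tbadd D) (tbscale D)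
              (X \<times> Te) (prod_diff D (sub_diff TH Te)) fst (triv_add D) (triv_scale D)
    \<and> dvs_iso (TB X D) TH fst (tbadd D) (tbscale D)
              (TB X D) TD fst (tbadd D) (tbscale D)
    \<and> dvs_iso (TB X D) TH fst (tbadd D) (tbscale D)
              (X \<times> Te) (prod_diff D (sub_diff TD Te)) fst (triv_add D) (triv_scale D)
    \<and> (\<forall>g\<in>X. sub_diff TH (Tfib X D g) = sub_diff TD (Tfib X D g))"
proof -
  interpret diff_group G D by unfold_locales (rule assms(1))
  \<comment> \<open>With equal diffeologies every claim about \<open>TD\<close> becomes one about
    \<open>TH\<close>, and the identity is the isomorphism between the two bundles.\<close>
  have "TD = TH" by (simp add: TD_def TH_def X_def dvs_diff_eq_hector)
  moreover have H: "dvs (TB X D) TH X D fst (tbadd D) (tbscale D) (tbzero D)"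
    unfolding X_def TH_def by (rule dvs_hector)
  moreover have "dvs (X \<times> Te) (prod_diff D (sub_diff TH Te)) X D fst (triv_add D) (triv_scale D) (triv_zero D e)"
    unfolding X_def TH_def Te_def e_def by (rule dvs_triv) simp
  moreover have "dvs_iso (TB X D) TH fst (tbadd D) (tbscale D)
      (X \<times> Te) (prod_diff D (sub_diff TH Te)) fst (triv_add D) (triv_scale D)"
    unfolding X_def TH_def Te_def e_def by (rule dvs_iso_triv)
  moreover note dvs_iso_refl[OF H]
  ultimately show ?thesis by simp
qed

end
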